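(* Let $\mathbb{K}$ be a field, let $n$ be a non-negative integer, and let $\mathcal{S}$ be a $\mathbb{K}$-linear subspace of $\mathrm{S}_n(\mathbb{K})$ whose codimension in $\mathrm{S}_n(\mathbb{K})$ satisfies $\operatorname{codim} \mathcal{S} \leq n-2$. Then every range-compatible homomorphism $F : \mathcal{S} \to \mathbb{K}^n$ is standard.
   Context: $\mathbb{K}$ is an arbitrary field. $\mathrm{S}_n(\mathbb{K})$ denotes the space of all $n\times n$ symmetric matrices with entries in $\mathbb{K}$; each such matrix is identified with a linear map $\mathbb{K}^n \to \mathbb{K}^n$, $X \mapsto MX$. "Homomorphism" means group homomorphism for addition (additive map); it is not assumed $\mathbb{K}$-linear. For a linear subspace $\mathcal{S}$ of $\mathrm{S}_n(\mathbb{K})$, a map $F : \mathcal{S} \to \mathbb{K}^n$ is range-compatible when $F(M) \in \operatorname{Im} M$ (the column space of $M$) for all $M \in \mathcal{S}$. A range-compatible homomorphism on $\mathcal{S}$ is called standard when it can be extended to a range-compatible homomorphism $\mathrm{S}_n(\mathbb{K}) \to \mathbb{K}^n$ on the full space $\mathrm{S}_n(\mathbb{K})$. *)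

theory Defs
  imports "Jordan_Normal_Form.VS_Connect"
begin

text \<open>
  \<open>sym_mat_space n\<close> is the space of symmetric matrices of size \<open>n\<close> over \<open>'a\<close>, and
  \<open>sym_mat_space n\<lparr>carrier := S\<rparr>\<close> is a linear subspace \<open>S\<close> of it, as a vector space in its own right.
  The ground field is always \<open>class_ring\<close>, the type \<open>'a\<close> seen as a ring record.
\<close>

definition sym_mat_space :: "nat \<Rightarrow> ('a :: field, 'a mat) module" where
  "sym_mat_space n = (module_mat TYPE('a) n n)\<lparr>carrier := {M \<in> carrier_mat n n. M\<^sup>T = M}\<rparr>"

lemma subspace_sym_mat_space:
  "VectorSpace.subspace (class_ring :: 'a :: field ring)
     (carrier (sym_mat_space n)) (module_mat TYPE('a) n n)"
proof -
  have "submodule (class_ring :: 'a ring) (carrier (sym_mat_space n)) (module_mat TYPE('a) n n)"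
    unfolding submodule_def sym_mat_space_def module_mat_simps
    using matrix_vs[of n n, where 'a='a]
    by (auto simp: vectorspace_def module_mat_simps transpose_add[of _ n n])
       (auto intro!: eq_matI simp: mat_eq_iff)
  then show ?thesis
    using matrix_vs[of n n, where 'a='a] by (simp add: VectorSpace.subspace_def)
qed

lemma vectorspace_sym_mat_space:
  "vectorspace (class_ring :: 'a :: field ring) (sym_mat_space n)"
  using vectorspace.subspace_is_vs[OF matrix_vs subspace_sym_mat_space[of n, where 'a='a]]
  by (simp add: sym_mat_space_def)

text \<open>Only meant for linear subspaces \<open>S\<close>; the space is finite-dimensional, so for these the
  subtraction is never truncated.\<close>

definition sym_codim :: "nat \<Rightarrow> 'a :: field mat set \<Rightarrow> nat" where
  "sym_codim n S =
     vectorspace.dim class_ring (sym_mat_space n :: ('a, 'a mat) module)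
     - vectorspace.dim class_ring ((sym_mat_space n :: ('a, 'a mat) module)\<lparr>carrier := S\<rparr>)"

text \<open>Homomorphisms are homomorphisms of additive groups; only the values on \<open>S\<close> matter.\<close>

definition range_compatible_hom :: "nat \<Rightarrow> 'a :: field mat set \<Rightarrow> ('a mat \<Rightarrow> 'a vec) \<Rightarrow> bool" where
  "range_compatible_hom n S F \<longleftrightarrow>
     F \<in> hom (add_monoid ((sym_mat_space n)\<lparr>carrier := S\<rparr>)) (add_monoid (module_vec TYPE('a) n)) \<and>
     (\<forall>M\<in>S. F M \<in> (\<lambda>X. M *\<^sub>v X) ` carrier_vec n)"

definition standard_hom :: "nat \<Rightarrow> 'a :: field mat set \<Rightarrow> ('a mat \<Rightarrow> 'a vec) \<Rightarrow> bool" where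
  "standard_hom n S F \<longleftrightarrow>
     range_compatible_hom n S F \<and>
     (\<exists>G. range_compatible_hom n (carrier (sym_mat_space n)) G \<and> (\<forall>M\<in>S. G M = F M))"

end

theory Submission
  imports Defs "HOL-Library.Function_Algebras"
begin

text \<open>
  Range compatibility of \<open>F\<close> gives: \<open>M v = 0\<close> implies \<open>v \<bullet> F M = 0\<close>. One shows that
  \<open>v \<bullet> F M = v \<bullet> M x + f (v \<bullet> M v)\<close> for a vector \<open>x\<close> and an additive \<open>f\<close> with \<open>f (c\<^sup>2 a) = c f a\<close>; such a map
  is defined and range-compatible on all symmetric matrices. The proof is an induction in which \<open>v\<close> is
  restricted to the orthogonal space of a list \<open>U\<close>, that is, the target is divided by the span of \<open>U\<close>.

  If \<open>y y\<^sup>T\<close> is not in the domain, then dividing by \<open>y\<close> lowers both the dimension and the codimension by one, and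
  the induction hypothesis yields \<open>(x, f)\<close> modulo \<open>y\<close>; if the domain is full, any \<open>y\<close> will do. There are two such directions \<open>y\<^sub>0\<close>, \<open>y\<^sub>1\<close>. If the
  two functions \<open>f\<close> agree, a dimension count shows that the two vectors \<open>x\<close> agree, and the
  formulas glue. If the functions differ, a dimension count forces the field to have two elements; then \<open>y\<^sub>0 + y\<^sub>1\<close> is a third
  such direction, and its function \<open>f\<close> agrees with one of the first two because only \<open>0\<close> and the identity are available.
  The induction starts with the full domain in dimension two, where polarizing the functional equation satisfied by
  the coordinates of \<open>F\<close> shows that their off-diagonal parts are linear.
\<close>

subsection \<open>Vectors and symmetric forms\<close>

text \<open>Vectors and matrices are functions on all of \<open>nat\<close>; \<open>dot n\<close> and \<open>row_comb n\<close> below ignore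
  the entries at indices \<open>\<ge> n\<close>, which are therefore arbitrary.\<close>

definition vscale :: "'a::field \<Rightarrow> (nat \<Rightarrow> 'a) \<Rightarrow> nat \<Rightarrow> 'a" where
  "vscale c v = (\<lambda>i. c * v i)"

definition mscale :: "'a::field \<Rightarrow> (nat \<Rightarrow> nat \<Rightarrow> 'a) \<Rightarrow> nat \<Rightarrow> nat \<Rightarrow> 'a" where
  "mscale c M = (\<lambda>i j. c * M i j)"

definition sym_prod :: "(nat \<Rightarrow> 'a::field) \<Rightarrow> (nat \<Rightarrow> 'a) \<Rightarrow> nat \<Rightarrow> nat \<Rightarrow> 'a" where
  "sym_prod y z = (\<lambda>i j. y i * z j + z i * y j)"

definition sq_form :: "(nat \<Rightarrow> 'a::field) \<Rightarrow> nat \<Rightarrow> nat \<Rightarrow> 'a" where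
  "sq_form y = (\<lambda>i j. y i * y j)"

definition sym_forms :: "(nat \<Rightarrow> nat \<Rightarrow> 'a::field) set" where
  "sym_forms = {M. \<forall>i j. M i j = M j i}"

definition form_subspace :: "(nat \<Rightarrow> nat \<Rightarrow> 'a::field) set \<Rightarrow> bool" where
  "form_subspace S \<longleftrightarrow> 0 \<in> S \<and> (\<forall>M\<in>S. \<forall>N\<in>S. M + N \<in> S) \<and> (\<forall>c. \<forall>M\<in>S. mscale c M \<in> S)"

definition extend_by :: "(nat \<Rightarrow> nat \<Rightarrow> 'a::field) set \<Rightarrow> (nat \<Rightarrow> nat \<Rightarrow> 'a) \<Rightarrow> (nat \<Rightarrow> nat \<Rightarrow> 'a) set" where
  "extend_by S w = {M + mscale c w |M c. M \<in> S}"

text \<open>\<open>spans_modulo S ws\<close> encodes that \<open>S\<close> has codimension at most \<open>length ws\<close> in the symmetric forms.\<close>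

primrec spans_modulo :: "(nat \<Rightarrow> nat \<Rightarrow> 'a::field) set \<Rightarrow> (nat \<Rightarrow> nat \<Rightarrow> 'a) list \<Rightarrow> bool" where
  "spans_modulo S [] \<longleftrightarrow> sym_forms \<subseteq> S"
| "spans_modulo S (w # ws) \<longleftrightarrow> spans_modulo (extend_by S w) ws"

lemma mscale_simps:
  "mscale 1 M = M" "mscale 0 M = 0" "mscale c 0 = 0" "mscale c (mscale d M) = mscale (c * d) M"
  "mscale c (M + N) = mscale c M + mscale c N" "mscale (c + d) M = mscale c M + mscale d M"
  "mscale (- c) M = - mscale c M" "mscale c (- M) = - mscale c M"
  "mscale (c - d) M = mscale c M - mscale d M" "mscale c (M - N) = mscale c M - mscale c N"
  by (auto simp: mscale_def fun_eq_iff algebra_simps)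

lemma vscale_simps:
  "vscale 1 v = v" "vscale 0 v = 0" "vscale c 0 = 0" "vscale c (vscale d v) = vscale (c * d) v"
  "vscale c (v + w) = vscale c v + vscale c w" "vscale (c + d) v = vscale c v + vscale d v"
  "vscale (- c) v = - vscale c v" "vscale c (- v) = - vscale c v"
  "vscale (c - d) v = vscale c v - vscale d v" "vscale c (v - w) = vscale c v - vscale c w"
  by (auto simp: vscale_def fun_eq_iff algebra_simps)

lemma form_subspaceD:
  assumes "form_subspace S"
  shows "0 \<in> S" "M \<in> S \<Longrightarrow> N \<in> S \<Longrightarrow> M + N \<in> S" "M \<in> S \<Longrightarrow> mscale c M \<in> S"
    "M \<in> S \<Longrightarrow> - M \<in> S" "M \<in> S \<Longrightarrow> N \<in> S \<Longrightarrow> M - N \<in> S"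
proof -
  show *: "0 \<in> S" "M \<in> S \<Longrightarrow> N \<in> S \<Longrightarrow> M + N \<in> S" "M \<in> S \<Longrightarrow> mscale c M \<in> S" for M N c
    using assms by (auto simp: form_subspace_def)
  show **: "M \<in> S \<Longrightarrow> - M \<in> S" for M
    using *(3)[of M "-1"] by (simp add: mscale_simps)
  show "M \<in> S \<Longrightarrow> N \<in> S \<Longrightarrow> M - N \<in> S"
    using *(2)[of M "-N"] **[of N] by simp
qed

lemma form_subspace_sym_forms: "form_subspace sym_forms"
  by (auto simp: form_subspace_def sym_forms_def mscale_def)

lemma sym_prod_sym_forms [simp]: "sym_prod y z \<in> sym_forms" and sq_form_sym_forms [simp]: "sq_form y \<in> sym_forms"
  by (auto simp: sym_forms_def sym_prod_def sq_form_def)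

lemma sq_form_add: "sq_form (y + z) = sq_form y + sq_form z + sym_prod y z"
  by (auto simp: fun_eq_iff sq_form_def sym_prod_def algebra_simps)

lemma sym_prod_add: "sym_prod y (z + z') = sym_prod y z + sym_prod y z'"
  by (auto simp: fun_eq_iff sym_prod_def algebra_simps)

lemma sym_prod_vscale: "sym_prod y (vscale c z) = mscale c (sym_prod y z)"
  by (auto simp: fun_eq_iff sym_prod_def vscale_def mscale_def algebra_simps)

section \<open>Adjoining forms to a subspace, and counting codimension\<close>

lemma form_subspace_extend_by: "form_subspace S \<Longrightarrow> form_subspace (extend_by S w)"
proof -
  assume S: "form_subspace S"
  note D = form_subspaceD[OF S]
  have "\<exists>M c. 0 = M + mscale c w \<and> M \<in> S"
    using D(1) by (intro exI[of _ 0] exI[of _ "0"]) (simp add: mscale_simps)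
  moreover have "\<exists>P e. M + mscale c w + (N + mscale d w) = P + mscale e w \<and> P \<in> S"
    if "M \<in> S" "N \<in> S" for M N c d
    using that D(2) by (intro exI[of _ "M + N"] exI[of _ "c + d"]) (simp add: mscale_simps algebra_simps)
  moreover have "\<exists>P e. mscale d (M + mscale c w) = P + mscale e w \<and> P \<in> S"
    if "M \<in> S" for M c d
    using that D(3) by (intro exI[of _ "mscale d M"] exI[of _ "d * c"]) (simp add: mscale_simps)
  ultimately show ?thesis
    unfolding form_subspace_def extend_by_def by fast
qed

lemma extend_by_superset: "S \<subseteq> extend_by S w"
proof
  fix M assume "M \<in> S"
  then show "M \<in> extend_by S w"
    unfolding extend_by_def by (intro CollectI exI[of _ M] exI[of _ 0]) (simp add: mscale_simps)
qed

lemma mem_extend_by: "form_subspace S \<Longrightarrow> w \<in> extend_by S w"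
  unfolding extend_by_def
  by (intro CollectI exI[of _ 0] exI[of _ 1]) (auto simp: mscale_simps form_subspace_def)

lemma extend_by_least: "form_subspace T \<Longrightarrow> S \<subseteq> T \<Longrightarrow> w \<in> T \<Longrightarrow> extend_by S w \<subseteq> T"
  by (auto simp: extend_by_def intro!: form_subspaceD(2,3))

lemma spans_modulo_mono: "spans_modulo S ws \<Longrightarrow> S \<subseteq> T \<Longrightarrow> spans_modulo T ws"
proof (induction ws arbitrary: S T)
  case (Cons w ws)
  have "extend_by S w \<subseteq> extend_by T w"
    using Cons.prems(2) by (auto simp: extend_by_def)
  with Cons show ?case by auto
qed auto

text \<open>Describing the span through all subspaces that contain \<open>S\<close> and
  \<open>ws\<close> avoids explicit linear combinations when a spanning set of matrices is
  transferred.\<close>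

lemma spans_moduloI:
  assumes "form_subspace S" "\<And>T. form_subspace T \<Longrightarrow> S \<subseteq> T \<Longrightarrow> set ws \<subseteq> T \<Longrightarrow> sym_forms \<subseteq> T"
  shows "spans_modulo S ws"
  using assms
proof (induction ws arbitrary: S)
  case (Cons w ws)
  have "sym_forms \<subseteq> T" if "form_subspace T" "extend_by S w \<subseteq> T" "set ws \<subseteq> T" for T
    using Cons.prems that extend_by_superset[of S w] mem_extend_by[of S w] by auto
  then show ?case
    using Cons.IH[of "extend_by S w"] Cons.prems(1) form_subspace_extend_by by auto
qed auto

text \<open>Steinitz exchange: the first \<open>w1\<close> whose adjunction captures
  \<open>w\<close> has a nonzero coefficient in \<open>w\<close>, so \<open>w\<close> can take its
  place.\<close>

lemma spans_modulo_exchange: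
  assumes "form_subspace S" "spans_modulo S ws" "w \<in> sym_forms" "w \<notin> S"
  shows "\<exists>ws'. spans_modulo (extend_by S w) ws' \<and> length ws = Suc (length ws')"
  using assms
proof (induction ws arbitrary: S)
  case (Cons w1 ws)
  show ?case
  proof (cases "w \<in> extend_by S w1")
    case True
    then obtain M c where M: "w = M + mscale c w1" "M \<in> S"
      by (auto simp: extend_by_def)
    with Cons.prems(4) have c: "c \<noteq> 0"
      by (auto simp: mscale_simps)
    have "w1 = mscale (inverse c) (w - M)"
      using M c by (simp add: mscale_simps)
    moreover have "w - M \<in> extend_by S w"
      using M mem_extend_by[of S w] extend_by_superset[of S w] form_subspace_extend_by[of S w] Cons.prems(1)
      by (intro form_subspaceD(5)) auto
    ultimately have "w1 \<in> extend_by S w"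
      using form_subspace_extend_by[of S w] Cons.prems(1) by (simp add: form_subspaceD(3))
    then have "extend_by S w1 \<subseteq> extend_by S w"
      using Cons.prems(1) by (intro extend_by_least form_subspace_extend_by extend_by_superset)
    then show ?thesis
      using Cons.prems(2) spans_modulo_mono by (intro exI[of _ ws]) auto
  next
    case False
    then obtain ws' where ws': "spans_modulo (extend_by (extend_by S w1) w) ws'" "length ws = Suc (length ws')"
      using Cons.IH[of "extend_by S w1"] Cons.prems form_subspace_extend_by by auto
    have "extend_by (extend_by S w1) w \<subseteq> extend_by (extend_by S w) w1"
      using Cons.prems(1) extend_by_superset[of S w] extend_by_superset[of "extend_by S w" w1]
        mem_extend_by[of S w] mem_extend_by[of "extend_by S w" w1]
      by (intro extend_by_least form_subspace_extend_by) (auto intro: form_subspace_extend_by)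
    then show ?thesis
      using ws' spans_modulo_mono by (intro exI[of _ "w1 # ws'"]) auto
  qed
qed auto

text \<open>Codimension enters here as a number of equations: beyond vanishing on \<open>S\<close>,
  only \<open>length ws\<close> further conditions have to be arranged.\<close>

lemma spans_modulo_vanish:
  fixes g :: "(nat \<Rightarrow> nat \<Rightarrow> 'a::field) \<Rightarrow> 'a"
  assumes "spans_modulo S ws" "\<And>M N. g (M + N) = g M + g N" "\<And>c M. g (mscale c M) = c * g M"
    and "\<And>M. M \<in> S \<Longrightarrow> g M = 0" "\<And>w. w \<in> set ws \<Longrightarrow> g w = 0" "M \<in> sym_forms"
  shows "g M = 0"
  using assms(1,4,5)
proof (induction ws arbitrary: S)
  case Nil
  then show ?case using assms(6) by auto
next
  case (Cons w ws)
  have "g N = 0" if "N \<in> extend_by S w" for N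
  proof -
    from that obtain N' c where "N = N' + mscale c w" "N' \<in> S" by (auto simp only: extend_by_def)
    then show ?thesis using Cons.prems(2,3) assms(2,3) by simp
  qed
  with Cons show ?case by auto
qed

section \<open>Pairing of vectors and action of forms, restricted to the first \<open>n\<close>
  entries\<close>

context
  fixes n :: nat
begin

definition dot :: "(nat \<Rightarrow> 'a::field) \<Rightarrow> (nat \<Rightarrow> 'a) \<Rightarrow> 'a" where
  "dot u v = (\<Sum>i<n. u i * v i)"

definition row_comb :: "(nat \<Rightarrow> nat \<Rightarrow> 'a::field) \<Rightarrow> (nat \<Rightarrow> 'a) \<Rightarrow> nat \<Rightarrow> 'a" where
  "row_comb M v = (\<lambda>j. \<Sum>i<n. v i * M i j)"

definition orth :: "(nat \<Rightarrow> 'a::field) list \<Rightarrow> (nat \<Rightarrow> 'a) set" where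
  "orth U = {v. \<forall>u\<in>set U. dot u v = 0}"

lemma dot_simps:
  "dot (u + u') v = dot u v + dot u' v" "dot u (v + v') = dot u v + dot u v'"
  "dot (vscale c u) v = c * dot u v" "dot u (vscale c v) = c * dot u v"
  "dot (- u) v = - dot u v" "dot u (- v) = - dot u v"
  "dot (u - u') v = dot u v - dot u' v" "dot u (v - v') = dot u v - dot u v'"
  "dot 0 v = 0" "dot u 0 = 0"
  by (simp_all add: dot_def vscale_def sum_distrib_left sum.distrib sum_negf sum_subtractf algebra_simps)

lemma row_comb_simps:
  "row_comb (M + N) v = row_comb M v + row_comb N v" "row_comb M (v + v') = row_comb M v + row_comb M v'"
  "row_comb (mscale c M) v = vscale c (row_comb M v)" "row_comb M (vscale c v) = vscale c (row_comb M v)"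
  "row_comb (- M) v = - row_comb M v" "row_comb M (- v) = - row_comb M v"
  "row_comb (M - N) v = row_comb M v - row_comb N v" "row_comb M (v - v') = row_comb M v - row_comb M v'"
  "row_comb 0 v = 0" "row_comb M 0 = 0"
  by (simp_all add: row_comb_def vscale_def mscale_def fun_eq_iff sum_distrib_left sum.distrib sum_negf
      sum_subtractf algebra_simps)

lemma dot_commute: "dot u v = dot v u"
  by (simp add: dot_def mult.commute)

lemma row_comb_sq_form: "row_comb (sq_form y) v = vscale (dot y v) y"
  by (simp add: row_comb_def sq_form_def vscale_def dot_def sum_distrib_left fun_eq_iff algebra_simps)

lemma row_comb_sym_prod: "row_comb (sym_prod y z) v = vscale (dot y v) z + vscale (dot z v) y"
  by (simp add: row_comb_def sym_prod_def vscale_def dot_def sum_distrib_left sum.distrib fun_eq_iff algebra_simps)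

lemma bil_commute:
  assumes "M \<in> sym_forms" shows "dot (row_comb M v) x = dot (row_comb M x) v"
proof -
  have "dot (row_comb M v) x = (\<Sum>j<n. \<Sum>i<n. v i * M i j * x j)"
    by (simp add: dot_def row_comb_def sum_distrib_right)
  also have "\<dots> = (\<Sum>i<n. \<Sum>j<n. v i * M i j * x j)"
    by (rule sum.swap)
  also have "\<dots> = dot (row_comb M x) v"
    using assms by (auto simp: dot_def row_comb_def sum_distrib_right sum_distrib_left sym_forms_def mult_ac intro!: sum.cong)
  finally show ?thesis .
qed

lemma dot_cong: "(\<And>i. i < n \<Longrightarrow> u i = u' i) \<Longrightarrow> (\<And>i. i < n \<Longrightarrow> v i = v' i) \<Longrightarrow> dot u v = dot u' v'"
  by (simp add: dot_def)

definition unit_fun :: "nat \<Rightarrow> nat \<Rightarrow> 'a::field" where "unit_fun k = (\<lambda>i. if i = k then 1 else 0)"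

lemma dot_unit_fun: "k < n \<Longrightarrow> dot u (unit_fun k) = u k" "k < n \<Longrightarrow> dot (unit_fun k) u = u k"
  by (auto simp: dot_def unit_fun_def if_distrib if_distribR cong: if_cong)

text \<open>Expansion in unit vectors; \<open>junk\<close> disposes of the entries from index
  \<open>n\<close> on.\<close>

lemma linear_functional_eq_dot:
  fixes g :: "(nat \<Rightarrow> 'a::field) \<Rightarrow> 'a"
  assumes add: "\<And>u v. g (u + v) = g u + g v" and sc: "\<And>c v. g (vscale c v) = c * g v"
    and junk: "\<And>v. (\<And>i. i < n \<Longrightarrow> v i = 0) \<Longrightarrow> g v = 0"
  shows "g v = dot v (\<lambda>i. g (unit_fun i))"
proof -
  have g0: "g 0 = 0"
    using sc[of 0 0] by (simp add: vscale_simps)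
  have *: "g (\<lambda>i. if i < m then v i else 0) = (\<Sum>i<m. v i * g (unit_fun i))" for m
  proof (induction m)
    case 0
    then show ?case using g0 by (simp add: zero_fun_def)
  next
    case (Suc m)
    have "(\<lambda>i. if i < Suc m then v i else 0) = (\<lambda>i. if i < m then v i else 0) + vscale (v m) (unit_fun m)"
      by (auto simp: fun_eq_iff vscale_def unit_fun_def less_Suc_eq)
    then show ?case
      using Suc by (simp add: add sc)
  qed
  have "g v = g ((\<lambda>i. if i < n then v i else 0) + (\<lambda>i. if i < n then 0 else v i))"
    by (rule arg_cong[of _ _ g]) auto
  also have "\<dots> = g (\<lambda>i. if i < n then v i else 0)"
    by (simp add: add junk)
  finally show ?thesis
    by (simp add: * dot_def)
qed

lemma orth_closed:
  "0 \<in> orth U" "v \<in> orth U \<Longrightarrow> w \<in> orth U \<Longrightarrow> v + w \<in> orth U" "v \<in> orth U \<Longrightarrow> vscale c v \<in> orth U"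
  "v \<in> orth U \<Longrightarrow> - v \<in> orth U" "v \<in> orth U \<Longrightarrow> w \<in> orth U \<Longrightarrow> v - w \<in> orth U"
  by (auto simp: orth_def dot_simps)

lemma orth_Cons: "v \<in> orth (u # U) \<longleftrightarrow> dot u v = 0 \<and> v \<in> orth U"
  by (auto simp: orth_def)

lemma orth_append: "orth (U @ U') = orth U \<inter> orth U'"
  by (auto simp: orth_def)

end

subsection \<open>Linear systems and duality\<close>

text \<open>Gaussian elimination: an equation \<open>r\<close> with nonzero last coefficient removes
  the last unknown from the other equations and afterwards determines it.\<close>

lemma homogeneous_system:
  fixes E :: "(nat \<Rightarrow> 'a::field) list"
  assumes "length E < n"
  shows "\<exists>v\<in>orth n E. \<exists>i<n. v i \<noteq> 0"
  using assms
proof (induction n arbitrary: E)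
  case (Suc n)
  show ?case
  proof (cases "\<exists>r\<in>set E. r n \<noteq> 0")
    case False
    have "dot (Suc n) r (unit_fun n) = r n" for r :: "nat \<Rightarrow> 'a"
      by (rule dot_unit_fun) simp
    with False have "unit_fun n \<in> orth (Suc n) E"
      by (auto simp: orth_def)
    then show ?thesis
      by (intro bexI[of _ "unit_fun n"]) (auto simp: unit_fun_def)
  next
    case True
    then obtain r where r: "r \<in> set E" "r n \<noteq> 0" by auto
    define E' where "E' = map (\<lambda>s. s - vscale (s n / r n) r) (remove1 r E)"
    have "length E' < n"
      using r(1) Suc.prems by (cases "length E") (auto simp: E'_def length_remove1)
    from Suc.IH[OF this] obtain v i where v: "v \<in> orth n E'" "i < n" "v i \<noteq> 0" by auto
    define w where "w = v(n := - dot n r v / r n)"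
    have w: "dot (Suc n) s w = dot n s v + s n * w n" for s
      by (simp add: dot_def w_def)
    have rw: "dot (Suc n) r w = 0"
      using r by (simp add: w) (simp add: w_def)
    have "dot (Suc n) s w = 0" if "s \<in> set E" for s
    proof (cases "s = r")
      case False
      with that have "s \<in> set (remove1 r E)" by (simp add: in_set_remove1)
      then have "dot n (s - vscale (s n / r n) r) v = 0"
        using v(1) by (auto simp: E'_def orth_def)
      then show ?thesis
        using r by (simp add: w dot_simps) (simp add: w_def)
    qed (use rw in simp)
    then show ?thesis
      using v by (intro bexI[of _ w] exI[of _ i]) (auto simp: w_def orth_def)
  qed
qed simp

context
  fixes n :: nat
begin

text \<open>Double orthogonality. Subtracting a suitable multiple of \<open>r\<close> makes
  \<open>b\<close> vanish on the orthogonal space of the remaining list; the multiple is read off at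
  a vector \<open>v1\<close> of that space that \<open>r\<close> does not kill.\<close>

lemma vanish_on_orth:
  fixes b :: "nat \<Rightarrow> 'a::field"
  assumes "\<forall>v\<in>orth n E. dot n b v = 0"
  shows "\<exists>c. \<forall>v. dot n b v = (\<Sum>k<length E. c k * dot n (E ! k) v)"
  using assms
proof (induction E arbitrary: b)
  case Nil
  then show ?case by (auto simp: orth_def)
next
  case (Cons r E)
  have "\<exists>a c. \<forall>v. dot n b v = a * dot n r v + (\<Sum>k<length E. c k * dot n (E ! k) v)"
  proof (cases "\<forall>v\<in>orth n E. dot n r v = 0")
    case True
    then have "\<forall>v\<in>orth n E. dot n b v = 0"
      using Cons.prems by (auto simp: orth_Cons)
    from Cons.IH[OF this] obtain c where "\<forall>v. dot n b v = (\<Sum>k<length E. c k * dot n (E ! k) v)" ..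
    then show ?thesis by (intro exI[of _ 0] exI[of _ c]) simp
  next
    case False
    then obtain v1 where v1: "v1 \<in> orth n E" "dot n r v1 \<noteq> 0" by auto
    define a where "a = dot n b v1 / dot n r v1"
    have "dot n (b - vscale a r) v = 0" if v: "v \<in> orth n E" for v
    proof -
      let ?w = "v - vscale (dot n r v / dot n r v1) v1"
      have "?w \<in> orth n (r # E)"
        using v v1 by (auto simp: orth_Cons dot_simps intro!: orth_closed)
      then have "dot n b ?w = 0" using Cons.prems by auto
      then show ?thesis
        using v1 by (simp add: dot_simps a_def field_simps)
    qed
    with Cons.IH[of "b - vscale a r"] obtain c
      where "\<forall>v. dot n (b - vscale a r) v = (\<Sum>k<length E. c k * dot n (E ! k) v)" by blast
    then show ?thesis
      by (intro exI[of _ a] exI[of _ c]) (simp add: dot_simps algebra_simps)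
  qed
  then obtain a c where "\<forall>v. dot n b v = a * dot n r v + (\<Sum>k<length E. c k * dot n (E ! k) v)"
    by blast
  then show ?case
    by (intro exI[of _ "\<lambda>k. case k of 0 \<Rightarrow> a | Suc k \<Rightarrow> c k"])
      (simp add: lessThan_Suc_eq_insert_0 sum.reindex zero_notin_Suc_image)
qed

text \<open>Linear independence in dual form: each vector is detected by a test vector orthogonal to
  the later ones, which is what a good direction provides.\<close>

primrec indep_list :: "(nat \<Rightarrow> 'a::field) list \<Rightarrow> bool" where
  "indep_list [] \<longleftrightarrow> True"
| "indep_list (y # U) \<longleftrightarrow> indep_list U \<and> (\<exists>v\<in>orth n U. dot n y v \<noteq> 0)"

text \<open>Evaluating the relation at a vector orthogonal to the tail but not to the head isolates
  the leading coefficient.\<close>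

lemma indep_list_combination:
  assumes "indep_list U" "\<And>v. (\<Sum>k<length U. c k * dot n (U ! k) v) = 0" "k < length U"
  shows "c k = 0"
  using assms
proof (induction U arbitrary: c k)
  case (Cons y U)
  from Cons.prems(1) obtain v where v: "v \<in> orth n U" "dot n y v \<noteq> 0" by auto
  have split: "(\<Sum>k<length (y # U). c k * dot n ((y # U) ! k) v)
      = c 0 * dot n y v + (\<Sum>k<length U. c (Suc k) * dot n (U ! k) v)" for v
    by (simp add: lessThan_Suc_eq_insert_0 sum.reindex zero_notin_Suc_image)
  have "(\<Sum>k<length U. c (Suc k) * dot n (U ! k) v) = 0"
    using v(1) by (intro sum.neutral) (auto simp: orth_def)
  with Cons.prems(2)[of v] v split have c0: "c 0 = 0" by auto
  show ?case
  proof (cases k)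
    case (Suc k')
    have "c (Suc k') = 0"
      by (rule Cons.IH[of "\<lambda>k. c (Suc k)" k']) (use Cons.prems split c0 Suc in auto)
    then show ?thesis using Suc by simp
  qed (use c0 in simp)
qed simp

lemma indep_list_length:
  assumes "indep_list U" shows "length U \<le> n"
proof (rule ccontr)
  assume "\<not> length U \<le> n"
  \<comment> \<open>The unknowns are the \<open>length U\<close> coefficients of a linear relation,
    with one equation for each of the \<open>n\<close> coordinates.\<close>
  then obtain c i where c: "c \<in> orth (length U) (map (\<lambda>j k. (U ! k) j) [0..<n])" "i < length U" "c i \<noteq> 0"
    using homogeneous_system[of "map (\<lambda>j k. (U ! k) j) [0..<n]" "length U"] by auto
  have j: "(\<Sum>k<length U. c k * (U ! k) j) = 0" if "j < n" for j
    using c(1) that by (simp add: orth_def dot_def mult.commute)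
  have "(\<Sum>k<length U. c k * dot n (U ! k) v) = 0" for v
  proof -
    have "(\<Sum>k<length U. c k * dot n (U ! k) v) = (\<Sum>k<length U. \<Sum>j<n. c k * (U ! k) j * v j)"
      by (simp add: dot_def sum_distrib_left mult.assoc)
    also have "\<dots> = (\<Sum>j<n. \<Sum>k<length U. c k * (U ! k) j * v j)"
      by (rule sum.swap)
    also have "\<dots> = (\<Sum>j<n. (\<Sum>k<length U. c k * (U ! k) j) * v j)"
      by (simp add: sum_distrib_right)
    finally show ?thesis by (simp add: j)
  qed
  with indep_list_combination[OF assms] c show False by blast
qed

lemma nonzero_dual:
  assumes "i < n" "v i \<noteq> 0"
  shows "\<exists>u. dot n u v = (1::'a::field)"
  using assms by (intro exI[of _ "vscale (1 / v i) (unit_fun i)"]) (simp add: dot_simps dot_unit_fun)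

lemma orth_nonzero:
  fixes U :: "(nat \<Rightarrow> 'a::field) list"
  assumes "length U < n"
  obtains v u where "v \<in> orth n U" "dot n u v = 1"
  using homogeneous_system[OF assms] nonzero_dual by blast

text \<open>Otherwise \<open>u\<close> would prolong \<open>U\<close> to \<open>n + 1\<close>
  independent vectors.\<close>

lemma orth_indep_list_full:
  assumes "indep_list U" "length U = n" "v \<in> orth n U"
  shows "dot n u v = 0"
proof (rule ccontr)
  assume "dot n u v \<noteq> 0"
  with assms have "indep_list (u # U)" by auto
  from indep_list_length[OF this] assms(2) show False by simp
qed

end

subsection \<open>Range-compatible pairings\<close>

text \<open>These are the maps that generate the nonlinear standard homomorphisms
  \<open>M \<mapsto> (f M\<^sub>1\<^sub>1, \<dots>, f M\<^sub>n\<^sub>n)\<close>; they vanish unless the characteristic is 2.\<close>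

definition root_linear :: "('a::field \<Rightarrow> 'a) \<Rightarrow> bool" where
  "root_linear f \<longleftrightarrow> (\<forall>a b. f (a + b) = f a + f b) \<and> (\<forall>c a. f (c * c * a) = c * f a)"

lemma root_linearD:
  assumes "root_linear f"
  shows "f (a + b) = f a + f b" "f (c * c * a) = c * f a" "f 0 = 0" "f (- a) = - f a"
    "f (a - b) = f a - f b" "f (a + a) = 0"
proof -
  have ad: "f (a + b) = f a + f b" and sq: "f (c * c * a) = c * f a" for a b c
    using assms by (auto simp: root_linear_def)
  show "f (a + b) = f a + f b" "f (c * c * a) = c * f a" by (rule ad sq)+
  show z: "f 0 = 0" using sq[of 0 0] by simp
  show neg: "f (- a) = - f a" for a
    using ad[of a "- a"] z by (simp add: eq_neg_iff_add_eq_0 add.commute)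
  show "f (a - b) = f a - f b"
    using ad[of a "- b"] neg[of b] by simp
  \<comment> \<open>Taking \<open>-1\<close> as a square root of \<open>1\<close> gives
    \<open>f a = - f a\<close>.\<close>
  show "f (a + a) = 0"
    using sq[of "-1" a] neg[of a] ad[of a a] by simp
qed

lemma root_linear_diff: "root_linear f \<Longrightarrow> root_linear g \<Longrightarrow> root_linear (\<lambda>a. f a - g a)"
  by (auto simp: root_linear_def algebra_simps)

context
  fixes n :: nat
begin

abbreviation bil :: "(nat \<Rightarrow> nat \<Rightarrow> 'a::field) \<Rightarrow> (nat \<Rightarrow> 'a) \<Rightarrow> (nat \<Rightarrow> 'a) \<Rightarrow> 'a" where
  "bil M v x \<equiv> dot n (row_comb n M v) x"

text \<open>The cross term occurs twice and \<open>f\<close> kills doubled values; a scalar leaves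
  the quadratic form as a square and leaves \<open>f\<close> as its root. So a quadratic expression
  becomes linear in \<open>v\<close>.\<close>

lemma root_linear_quad:
  assumes f: "root_linear f" and M: "M \<in> sym_forms"
  shows "f (bil M (v + w) (v + w)) = f (bil M v v) + f (bil M w w)"
    "f (bil M (vscale c v) (vscale c v)) = c * f (bil M v v)"
proof -
  have "bil M (v + w) (v + w) = bil M v v + bil M w w + (bil M v w + bil M v w)"
    using bil_commute[OF M, of n v w] by (simp add: dot_simps row_comb_simps)
  then show "f (bil M (v + w) (v + w)) = f (bil M v v) + f (bil M w w)"
    using root_linearD(1,6)[OF f] by simp
  show "f (bil M (vscale c v) (vscale c v)) = c * f (bil M v v)"
    using root_linearD(2)[OF f, of c "bil M v v"] by (simp add: dot_simps row_comb_simps mult.assoc)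
qed

lemma row_comb_junk: "(\<And>i. i < n \<Longrightarrow> v i = 0) \<Longrightarrow> row_comb n M v = 0"
  by (simp add: row_comb_def fun_eq_iff)

lemma row_comb_unit: "i < n \<Longrightarrow> row_comb n M (unit_fun i) = M i"
  by (auto simp: row_comb_def unit_fun_def fun_eq_iff if_distrib if_distribR cong: if_cong)

text \<open>By linearity in \<open>v\<close>, unit vectors suffice, and there the quadratic form
  takes the diagonal entries as values.\<close>

lemma root_linear_diag:
  assumes f: "root_linear f" and M: "M \<in> sym_forms"
  shows "f (bil M v v) = dot n v (\<lambda>i. f (M i i))"
proof -
  have "f (bil M v v) = dot n v (\<lambda>i. f (bil M (unit_fun i) (unit_fun i)))"
  proof (rule linear_functional_eq_dot)
    show "f (bil M v v) = 0" if "\<And>i. i < n \<Longrightarrow> v i = 0" for v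
      using row_comb_junk[of v M] that root_linearD(3)[OF f] by (simp only: dot_simps)
  qed (simp_all only: root_linear_quad[OF f M])
  also have "\<dots> = dot n v (\<lambda>i. f (M i i))"
    by (rule dot_cong) (simp_all add: row_comb_unit dot_unit_fun)
  finally show ?thesis .
qed

text \<open>A pairing \<open>B v M\<close> on test vectors \<open>v \<in> orth n U\<close> plays the role of \<open>v \<bullet> F M\<close>, where \<open>F\<close> takes values
  in the quotient of the column space by the span of \<open>U\<close>. Forms that vanish on all test vectors are invisible,
  so they may be assumed to lie in the domain.\<close>

definition annihilator :: "(nat \<Rightarrow> 'a::field) list \<Rightarrow> (nat \<Rightarrow> nat \<Rightarrow> 'a) set" where
  "annihilator U = {M \<in> sym_forms. \<forall>v\<in>orth n U. \<forall>x. bil M v x = 0}"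

definition rc_pairing :: "(nat \<Rightarrow> 'a::field) list \<Rightarrow> (nat \<Rightarrow> nat \<Rightarrow> 'a) set
    \<Rightarrow> ((nat \<Rightarrow> 'a) \<Rightarrow> (nat \<Rightarrow> nat \<Rightarrow> 'a) \<Rightarrow> 'a) \<Rightarrow> bool" where
  "rc_pairing U S B \<longleftrightarrow> form_subspace S \<and> S \<subseteq> sym_forms \<and> annihilator U \<subseteq> S \<and>
     (\<forall>v\<in>orth n U. \<forall>w\<in>orth n U. \<forall>M\<in>S. B (v + w) M = B v M + B w M) \<and>
     (\<forall>c. \<forall>v\<in>orth n U. \<forall>M\<in>S. B (vscale c v) M = c * B v M) \<and>
     (\<forall>v\<in>orth n U. \<forall>M\<in>S. \<forall>N\<in>S. B v (M + N) = B v M + B v N) \<and>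
     (\<forall>v\<in>orth n U. \<forall>M\<in>S. (\<forall>x. bil M v x = 0) \<longrightarrow> B v M = 0)"

text \<open>\<open>x\<close> and \<open>f\<close> are parameters so that solutions found along
  different directions can be compared.\<close>

definition standard_pairing :: "(nat \<Rightarrow> 'a::field) list \<Rightarrow> (nat \<Rightarrow> nat \<Rightarrow> 'a) set
    \<Rightarrow> ((nat \<Rightarrow> 'a) \<Rightarrow> (nat \<Rightarrow> nat \<Rightarrow> 'a) \<Rightarrow> 'a) \<Rightarrow> (nat \<Rightarrow> 'a) \<Rightarrow> ('a \<Rightarrow> 'a) \<Rightarrow> bool" where
  "standard_pairing U S B x f \<longleftrightarrow> root_linear f \<and> (\<forall>v\<in>orth n U. \<forall>M\<in>S. B v M = bil M v x + f (bil M v v))"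

lemma rc_pairingD:
  assumes "rc_pairing U S B"
  shows "form_subspace S" "S \<subseteq> sym_forms" "annihilator U \<subseteq> S"
    "v \<in> orth n U \<Longrightarrow> w \<in> orth n U \<Longrightarrow> M \<in> S \<Longrightarrow> B (v + w) M = B v M + B w M"
    "v \<in> orth n U \<Longrightarrow> M \<in> S \<Longrightarrow> B (vscale c v) M = c * B v M"
    "v \<in> orth n U \<Longrightarrow> M \<in> S \<Longrightarrow> N \<in> S \<Longrightarrow> B v (M + N) = B v M + B v N"
    "v \<in> orth n U \<Longrightarrow> M \<in> S \<Longrightarrow> (\<And>x. bil M v x = 0) \<Longrightarrow> B v M = 0"
  using assms unfolding rc_pairing_def by blast+

text \<open>The difference of the two forms kills \<open>v\<close>. Hence \<open>B v M\<close>
  depends on \<open>M\<close> only through its action on \<open>v\<close>.\<close>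

lemma rc_pairing_cong:
  assumes rc: "rc_pairing U S B" and v: "v \<in> orth n U" and M: "M \<in> S" "N \<in> S"
    and eq: "\<And>x. bil M v x = bil N v x"
  shows "B v M = B v N"
proof -
  have MN: "M - N \<in> S" using form_subspaceD(5)[OF rc_pairingD(1)[OF rc]] M by blast
  have "B v M = B v ((M - N) + N)" by simp
  also have "\<dots> = B v (M - N) + B v N" using rc_pairingD(6)[OF rc v MN M(2)] .
  also have "B v (M - N) = 0" using rc_pairingD(7)[OF rc v MN] eq by (simp add: row_comb_simps dot_simps)
  finally show ?thesis by simp
qed

lemma form_subspace_annihilator: "form_subspace (annihilator U)"
  using form_subspaceD[OF form_subspace_sym_forms] by (auto simp: form_subspace_def annihilator_def row_comb_simps dot_simps)

lemma sq_form_annihilator: "sq_form y \<in> annihilator (y # U)"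
  by (auto simp: annihilator_def orth_Cons row_comb_sq_form dot_simps)

definition form_sum :: "(nat \<Rightarrow> nat \<Rightarrow> 'a::field) set \<Rightarrow> (nat \<Rightarrow> nat \<Rightarrow> 'a) set \<Rightarrow> (nat \<Rightarrow> nat \<Rightarrow> 'a) set" where
  "form_sum S T = {M + N |M N. M \<in> S \<and> N \<in> T}"

lemma form_sumE:
  assumes "M \<in> form_sum S T" obtains s N where "M = s + N" "s \<in> S" "N \<in> T"
  using assms unfolding form_sum_def by blast

lemma form_sumI: "s \<in> S \<Longrightarrow> N \<in> T \<Longrightarrow> s + N \<in> form_sum S T"
  unfolding form_sum_def by blast

lemma form_sum_props:
  assumes S: "form_subspace S" and T: "form_subspace T"
  shows "form_subspace (form_sum S T)" "S \<subseteq> form_sum S T" "T \<subseteq> form_sum S T"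
proof -
  note DS = form_subspaceD[OF S] and DT = form_subspaceD[OF T]
  show "form_subspace (form_sum S T)"
    unfolding form_subspace_def
  proof (intro conjI ballI allI)
    show "0 \<in> form_sum S T" using form_sumI[OF DS(1) DT(1)] by simp
    fix M assume M: "M \<in> form_sum S T"
    then obtain s t where st: "M = s + t" "s \<in> S" "t \<in> T" by (rule form_sumE)
    show "mscale c M \<in> form_sum S T" for c
      unfolding st mscale_simps by (intro form_sumI DS DT st)
    fix N assume "N \<in> form_sum S T"
    then obtain s' t' where st': "N = s' + t'" "s' \<in> S" "t' \<in> T" by (rule form_sumE)
    have "(s + s') + (t + t') \<in> form_sum S T" by (intro form_sumI DS DT st st')
    then show "M + N \<in> form_sum S T" unfolding st st' by (simp add: ac_simps)
  qed
  show "S \<subseteq> form_sum S T" using form_sumI[OF _ DT(1)] by (auto simp del: zero_fun_apply)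
  show "T \<subseteq> form_sum S T" using form_sumI[OF DS(1)] by (auto simp del: zero_fun_apply)
qed

text \<open>Division by \<open>y\<close>: the forms in the new annihilator act as zero on the
  remaining test vectors, so they can be adjoined to the domain without affecting values.\<close>

lemma rc_pairing_extend:
  assumes rc: "rc_pairing U S B"
  shows "\<exists>B'. rc_pairing (y # U) (form_sum S (annihilator (y # U))) B' \<and>
    (\<forall>v\<in>orth n (y # U). \<forall>M\<in>S. B' v M = B v M)"
proof -
  let ?K = "annihilator (y # U)"
  let ?T = "form_sum S ?K"
  \<comment> \<open>A representative in \<open>S\<close> is picked by choice. Two representatives
    differ by a form in the annihilator, so on the new test vectors \<open>B'\<close> does not
    depend on the choice.\<close>
  define p where "p M = (SOME s. s \<in> S \<and> M - s \<in> ?K)" for M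
  define B' where "B' v M = B v (p M)" for v M
  note S = rc_pairingD(1)[OF rc]
  note DS = form_subspaceD[OF S] and DK = form_subspaceD[OF form_subspace_annihilator[of "y # U"]]
  note T = form_sum_props[OF S form_subspace_annihilator[of "y # U"]]
  have sub: "v \<in> orth n U" if "v \<in> orth n (y # U)" for v
    using that by (simp add: orth_Cons)
  have B': "B' v (s + N) = B v s" if v: "v \<in> orth n (y # U)" and s: "s \<in> S" and N: "N \<in> ?K" for v s N
  proof -
    have ex: "\<exists>s'. s' \<in> S \<and> (s + N) - s' \<in> ?K" using s N by (intro exI[of _ s]) simp
    have p: "p (s + N) \<in> S" "(s + N) - p (s + N) \<in> ?K"
      using someI_ex[OF ex] unfolding p_def by auto
    have "((s + N) - p (s + N)) - N \<in> ?K"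
      by (rule DK(5)[OF p(2) N])
    then have "s - p (s + N) \<in> ?K"
      by simp
    then have "bil (s - p (s + N)) v x = 0" for x
      using v unfolding annihilator_def by blast
    then have "bil s v x = bil (p (s + N)) v x" for x
      by (simp add: row_comb_simps dot_simps)
    from rc_pairing_cong[OF rc sub[OF v] s p(1) this] show ?thesis by (simp add: B'_def)
  qed
  have B'S: "B' v M = B v M" if "v \<in> orth n (y # U)" "M \<in> S" for v M
    using B'[OF that DK(1)] by simp
  have "rc_pairing (y # U) ?T B'"
    unfolding rc_pairing_def
  proof (intro conjI ballI allI impI)
    show "form_subspace ?T" "?K \<subseteq> ?T" by (fact T)+
    show "?T \<subseteq> sym_forms"
    proof
      fix M assume "M \<in> ?T"
      then obtain s N where "M = s + N" "s \<in> S" "N \<in> ?K" by (rule form_sumE)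
      then show "M \<in> sym_forms"
        using form_subspaceD(2)[OF form_subspace_sym_forms] rc_pairingD(2)[OF rc] by (auto simp: annihilator_def simp del: plus_fun_apply)
    qed
    fix v assume v: "v \<in> orth n (y # U)"
    {
      fix w M assume w: "w \<in> orth n (y # U)" and "M \<in> ?T"
      then obtain s N where M: "M = s + N" "s \<in> S" "N \<in> ?K" by (auto elim: form_sumE)
      show "B' (v + w) M = B' v M + B' w M"
        unfolding M(1) using v w M by (simp add: B' orth_closed rc_pairingD(4)[OF rc] sub)
    next
      fix M c assume "M \<in> ?T"
      then obtain s N where M: "M = s + N" "s \<in> S" "N \<in> ?K" by (auto elim: form_sumE)
      show "B' (vscale c v) M = c * B' v M"
        unfolding M(1) using v M by (simp add: B' orth_closed rc_pairingD(5)[OF rc] sub)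
    next
      fix M N assume "M \<in> ?T" "N \<in> ?T"
      then obtain s t s' t' where M: "M = s + t" "s \<in> S" "t \<in> ?K"
        and N: "N = s' + t'" "s' \<in> S" "t' \<in> ?K" by (auto elim!: form_sumE)
      have "B' v (M + N) = B' v ((s + s') + (t + t'))"
        unfolding M(1) N(1) by (simp add: ac_simps)
      also have "\<dots> = B v (s + s')" by (intro B' v DS DK M N)
      also have "\<dots> = B' v M + B' v N"
        unfolding M(1) N(1) using v M N by (simp add: B' rc_pairingD(6)[OF rc] sub)
      finally show "B' v (M + N) = B' v M + B' v N" .
    next
      fix M assume "M \<in> ?T" and z: "\<forall>x. bil M v x = 0"
      then obtain s t where M: "M = s + t" "s \<in> S" "t \<in> ?K" by (auto elim: form_sumE)
      have "bil t v x = 0" for x using M(3) v unfolding annihilator_def by blast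
      then have "bil s v x = 0" for x
        using z[rule_format, of x] unfolding M(1) by (simp add: row_comb_simps dot_simps)
      then have "B v s = 0" using rc_pairingD(7)[OF rc sub[OF v] M(2)] by blast
      then show "B' v M = 0" unfolding M(1) using B'[OF v M(2,3)] by simp
    }
  qed
  then show ?thesis using B'S by blast
qed

section \<open>Dimension counts for symmetric forms\<close>

text \<open>The square of \<open>u\<close> shows that \<open>u\<close> is orthogonal to
  \<open>x\<close>; after that, the product of \<open>u\<close> and \<open>y\<close> sees only the
  pairing of \<open>y\<close> with \<open>x\<close>.\<close>

lemma nondegenerate:
  assumes u: "dot n u v = 1" and z: "\<And>M. M \<in> sym_forms \<Longrightarrow> bil M v x = 0"
  shows "dot n y x = 0"
proof -
  have "dot n u x = 0" using z[of "sq_form u"] u by (simp add: row_comb_sq_form dot_simps)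
  then show ?thesis using z[of "sym_prod u y"] u by (simp add: row_comb_sym_prod dot_simps)
qed

text \<open>Fewer than \<open>n\<close> linear conditions on \<open>v\<close> make
  \<open>bil M v x\<close>, as a functional of \<open>M\<close>, vanish on \<open>S\<close> and on
  \<open>ws\<close>. So a nonzero such \<open>v\<close> exists, and \<open>nondegenerate\<close>
  applies.\<close>

lemma vanish_form:
  assumes sp: "spans_modulo S ws" and len: "length ws + length U < n"
    and z: "\<And>v M. v \<in> orth n U \<Longrightarrow> M \<in> S \<Longrightarrow> bil M v x = 0"
  shows "dot n y x = 0"
proof -
  obtain v u where v: "v \<in> orth n (map (\<lambda>w i. \<Sum>j<n. w i j * x j) ws @ U)" and u: "dot n u v = 1"
    using len by (rule_tac orth_nonzero[of "map (\<lambda>w i. \<Sum>j<n. w i j * x j) ws @ U"]) auto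
  have row: "bil w v x = dot n (\<lambda>i. \<Sum>j<n. w i j * x j) v" for w
    unfolding dot_def row_comb_def sum_distrib_right by (subst sum.swap) (simp add: mult_ac)
  have "bil M v x = 0" if "M \<in> sym_forms" for M
  proof (rule spans_modulo_vanish[OF sp, of "\<lambda>M. bil M v x"])
    show "bil w v x = 0" if "w \<in> set ws" for w
      unfolding row using v that by (auto simp: orth_append) (auto simp: orth_def)
  qed (use z v that in \<open>auto simp: row_comb_simps dot_simps orth_append\<close>)
  from nondegenerate[OF u this] show ?thesis by blast
qed

text \<open>Over two elements squaring is the identity, so the quadratic form is linear in
  \<open>v\<close> and the count of \<open>vanish_form\<close> still works. At the vector
  \<open>v\<close> found, every symmetric form pairs \<open>v\<close> with \<open>x + v\<close> to
  zero.\<close>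

lemma two_element_vanish_form:
  fixes x :: "nat \<Rightarrow> 'a::field"
  assumes F2: "\<And>c::'a. c = 0 \<or> c = 1"
    and sp: "spans_modulo S ws" and len: "length ws + length U < n" and S: "S \<subseteq> sym_forms"
    and z: "\<And>v M. v \<in> orth n U \<Longrightarrow> M \<in> S \<Longrightarrow> bil M v x + bil M v v = 0"
  shows "\<exists>v\<in>orth n U. \<forall>y. dot n y x = - dot n y v"
proof -
  have id: "root_linear (id :: 'a \<Rightarrow> 'a)"
    unfolding root_linear_def id_def using F2 by (metis mult.left_neutral mult_zero_left)
  \<comment> \<open>Writing the quadratic form through the diagonal makes the conditions for
    \<open>ws\<close> linear in \<open>v\<close>.\<close>
  define r where "r w i = (\<Sum>j<n. w i j * x j) + w i i" for w :: "nat \<Rightarrow> nat \<Rightarrow> 'a" and i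
  obtain v u where v: "v \<in> orth n (map r ws @ U)" and u: "dot n u v = 1"
    using len by (rule_tac orth_nonzero[of "map r ws @ U"]) auto
  have row: "bil w v x + dot n (\<lambda>i. w i i) v = dot n (r w) v" for w
    unfolding dot_def row_comb_def sum_distrib_right r_def
    by (subst sum.swap) (simp add: algebra_simps sum.distrib sum_distrib_left)
  have diag: "bil M v v = dot n (\<lambda>i. M i i) v" if "M \<in> sym_forms" for M
    using root_linear_diag[OF id that, of v] by (simp add: dot_commute)
  have "bil M v x + dot n (\<lambda>i. M i i) v = 0" if "M \<in> sym_forms" for M
  proof (rule spans_modulo_vanish[OF sp, of "\<lambda>M. bil M v x + dot n (\<lambda>i. M i i) v"])
    show "bil w v x + dot n (\<lambda>i. w i i) v = 0" if "w \<in> set ws" for w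
      unfolding row using v that by (auto simp: orth_append) (auto simp: orth_def)
    show "bil M v x + dot n (\<lambda>i. M i i) v = 0" if "M \<in> S" for M
      using z[of v M] v that S diag[of M] by (auto simp: orth_append)
    show "bil (M + N) v x + dot n (\<lambda>i. (M + N) i i) v =
      bil M v x + dot n (\<lambda>i. M i i) v + (bil N v x + dot n (\<lambda>i. N i i) v)" for M N
      by (simp add: row_comb_simps dot_simps) (simp add: dot_def algebra_simps sum.distrib)
    show "bil (mscale c M) v x + dot n (\<lambda>i. mscale c M i i) v = c * (bil M v x + dot n (\<lambda>i. M i i) v)" for c M
      by (simp add: row_comb_simps dot_simps) (simp add: dot_def mscale_def algebra_simps sum_distrib_left)
  qed (use that in auto)
  then have "bil M v (x + v) = 0" if "M \<in> sym_forms" for M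
    using that diag[of M] by (simp add: dot_simps)
  from nondegenerate[OF u this] have "dot n y (x + v) = 0" for y by blast
  then have "dot n y x = - dot n y v" for y
    by (simp add: dot_simps eq_neg_iff_add_eq_0)
  then show ?thesis using v by (auto simp: orth_append)
qed

text \<open>If the square of \<open>u\<close> lies in \<open>S\<close>, it is the witness. Otherwise
  it is adjoined and the test vectors are made orthogonal to \<open>u\<close>, which renders it
  invisible; one list shrinks while the other grows, so the bound persists.\<close>

lemma diagonal_nonzero:
  assumes "form_subspace S" "spans_modulo S ws" "length ws + length U < n"
  shows "\<exists>v\<in>orth n U. \<exists>M\<in>S. bil M v v \<noteq> 0"
  using assms
proof (induction "length ws" arbitrary: S ws U)
  case 0
  obtain v u where "v \<in> orth n U" "dot n u v = 1"
    using 0 by (rule_tac orth_nonzero[of U n]) auto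
  then show ?case
    using 0 by (intro bexI[of _ v] bexI[of _ "sq_form u"]) (auto simp: row_comb_sq_form dot_simps)
next
  case (Suc k)
  obtain v u where vu: "v \<in> orth n U" "dot n u v = 1"
    using Suc.prems by (rule_tac orth_nonzero[of U n]) auto
  show ?case
  proof (cases "sq_form u \<in> S")
    case True
    then show ?thesis
      using vu by (intro bexI[of _ v] bexI[of _ "sq_form u"]) (auto simp: row_comb_sq_form dot_simps)
  next
    case False
    obtain ws' where ws': "spans_modulo (extend_by S (sq_form u)) ws'" "length ws = Suc (length ws')"
      using spans_modulo_exchange[OF Suc.prems(1,2) sq_form_sym_forms False] by auto
    then obtain w M where w: "w \<in> orth n (u # U)" "M \<in> extend_by S (sq_form u)" "bil M w w \<noteq> 0"
      using Suc.hyps(1)[of ws' "extend_by S (sq_form u)" "u # U"] Suc.hyps(2) Suc.prems form_subspace_extend_by by fastforce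
    then obtain N c where N: "M = N + mscale c (sq_form u)" "N \<in> S" by (auto simp only: extend_by_def)
    have "bil N w w \<noteq> 0"
      using w unfolding N by (simp add: row_comb_simps dot_simps row_comb_sq_form orth_Cons)
    then show ?thesis using w(1) N(2) by (auto simp: orth_Cons)
  qed
qed

end

subsection \<open>The two-dimensional case\<close>

text \<open>Replacing \<open>t\<close> by \<open>r + 1\<close> and subtracting gives
  \<open>pol\<close>, from which \<open>h\<close> has dropped out. Its instances
  \<open>(m, 1)\<close> and \<open>(1, m)\<close> have the same left side, and comparing them gives
  linearity.\<close>

lemma polarized_linear:
  fixes g h P Q :: "'a::field \<Rightarrow> 'a"
  assumes g: "\<And>a b. g (a + b) = g a + g b" and P: "\<And>a b. P (a + b) = P a + P b"
    and Q: "\<And>a b. Q (a + b) = Q a + Q b"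
    and eq: "\<And>m t. g (m * t * t) + P (m * t) = t * Q (m * t) + t * h m"
  shows "Q m = m * Q 1"
proof -
  have pol: "g (m * r + m * r) = r * Q m + Q (m * r)" for m r
  proof -
    have "g (m * (r + 1) * (r + 1)) = g (m * r * r) + (g (m * r + m * r) + g m)"
      unfolding g[symmetric] by (rule arg_cong[of _ _ g]) (simp add: algebra_simps)
    moreover have "P (m * (r + 1)) = P (m * r) + P m" "Q (m * (r + 1)) = Q (m * r) + Q m"
      by (simp_all add: distrib_left P Q)
    ultimately have "g (m * r + m * r) = (g (m * (r + 1) * (r + 1)) + P (m * (r + 1)))
        - (g (m * r * r) + P (m * r)) - (g m + P m)"
      by simp
    also have "\<dots> = (r + 1) * (Q (m * r) + Q m) + (r + 1) * h m - (r * Q (m * r) + r * h m) - (Q m + h m)"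
      unfolding eq[of m "r + 1"] eq[of m r] using eq[of m 1] by (simp add: distrib_left Q)
    finally show ?thesis by (simp add: algebra_simps)
  qed
  show ?thesis
    using pol[of m 1] pol[of 1 m] by simp
qed

context
  fixes n :: nat
begin

text \<open>On a basis \<open>v1\<close>, \<open>v2\<close> of the test space, \<open>B\<close>
  amounts to two functions \<open>b1\<close>, \<open>b2\<close> of the images of \<open>v1\<close>
  and \<open>v2\<close> under \<open>M\<close>. Forms that kill a combination of \<open>v1\<close>
  and \<open>v2\<close> relate these functions.\<close>

lemma standard_pairing_two_dim:
  assumes rc: "rc_pairing n U S B" and S: "sym_forms \<subseteq> S" and U: "indep_list n U" "length U + 2 = n"
  shows "\<exists>x f. standard_pairing n U S B x f"
proof -
  obtain v1 y1 where v1: "v1 \<in> orth n U" and y1v1: "dot n y1 v1 = 1"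
    using U by (rule_tac orth_nonzero[of U n]) auto
  obtain v2 u2 where v2': "v2 \<in> orth n (y1 # U)" and u2v2: "dot n u2 v2 = 1"
    using U by (rule_tac orth_nonzero[of "y1 # U" n]) auto
  then have v2: "v2 \<in> orth n U" and y1v2: "dot n y1 v2 = 0" by (auto simp: orth_Cons)
  \<comment> \<open>The correction makes \<open>y1\<close>, \<open>y2\<close> dual to
    \<open>v1\<close>, \<open>v2\<close>.\<close>
  define y2 where "y2 = u2 - vscale (dot n u2 v1) y1"
  have y2v: "dot n y2 v1 = 0" "dot n y2 v2 = 1"
    by (simp_all add: y2_def dot_simps y1v1 y1v2 u2v2)
  note yv = y1v1 y1v2 y2v
  note DSym = form_subspaceD[OF form_subspace_sym_forms]
  note rcD = rc_pairingD[OF rc]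

  \<comment> \<open>A symmetric form that sends \<open>v\<close> to a prescribed \<open>p\<close>
    whenever \<open>dot n y v = 1\<close>.\<close>
  define m where "m y v p = sym_prod y p - mscale (dot n p v) (sq_form y)" for y v p :: "nat \<Rightarrow> 'a"
  have mSym: "m y v p \<in> sym_forms" for y v p
    unfolding m_def by (intro DSym sym_prod_sym_forms sq_form_sym_forms)
  have app_m: "row_comb n (m y v p) v = p" if "dot n y v = 1" for y v p
    using that by (simp add: m_def row_comb_simps row_comb_sym_prod row_comb_sq_form vscale_simps)
  have m_add: "m y v (p + q) = m y v p + m y v q" for y v p q
    by (simp add: m_def sym_prod_add dot_simps mscale_simps algebra_simps)
  define b1 b2 where "b1 p = B v1 (m y1 v1 p)" and "b2 p = B v2 (m y2 v2 p)" for p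
  have b1M: "B v1 M = b1 (row_comb n M v1)" and b2M: "B v2 M = b2 (row_comb n M v2)" if "M \<in> sym_forms" for M
    unfolding b1_def b2_def
    by (rule rc_pairing_cong[OF rc]; use that S mSym v1 v2 in \<open>auto simp: app_m yv\<close>)+
  have b_add: "b1 (p + q) = b1 p + b1 q" "b2 (p + q) = b2 p + b2 q" for p q
    unfolding b1_def b2_def m_add using S mSym v1 v2 by (intro rcD(6); blast)+
  have b1_junk: "b1 p = 0" if "\<And>i. i < n \<Longrightarrow> p i = 0" for p
  proof -
    have "dot n p x = 0" for x by (simp add: dot_def that)
    then show ?thesis
      unfolding b1_def using S mSym v1 by (intro rcD(7)) (auto simp: app_m yv)
  qed
  have b_zero: "b1 0 = 0" "b2 0 = 0"
    using b_add[of 0 0] by (metis add_0_right add_cancel_right_right)+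
  have b_neg: "b1 (- p) = - b1 p" "b2 (- p) = - b2 p" for p
    using b_add[of p "- p"] b_zero by (simp_all add: eq_neg_iff_add_eq_0 add.commute)
  have b_diff: "b1 (p - q) = b1 p - b1 q" "b2 (p - q) = b2 p - b2 q" for p q
    using b_add[of p "- q"] b_neg by simp_all

  \<comment> \<open>\<open>M\<close> is built from \<open>y'\<close> and \<open>z\<close>, both
    orthogonal to \<open>w\<close>, so it kills \<open>w\<close>. Expanding \<open>B w M = 0\<close>
    over \<open>v1\<close> and \<open>v2\<close> gives the relation.\<close>
  have key: "s * b1 (vscale (c * t) (vscale t y1 - vscale s y2) + vscale t z)
      = t * b2 (vscale (c * s) (vscale t y1 - vscale s y2) + vscale s z)"
    if z: "dot n z v1 = 0" "dot n z v2 = 0" for s t c z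
  proof -
    define y' where "y' = vscale t y1 - vscale s y2"
    define M where "M = mscale c (sq_form y') + sym_prod y' z"
    define w where "w = vscale s v1 + vscale t v2"
    have M: "M \<in> sym_forms" unfolding M_def by (intro DSym sym_prod_sym_forms sq_form_sym_forms)
    have y': "dot n y' v1 = t" "dot n y' v2 = - s" "dot n y' w = 0"
      by (simp_all add: y'_def w_def dot_simps yv)
    have zw: "dot n z w = 0" by (simp add: w_def dot_simps z)
    have "row_comb n M w = 0"
      by (simp only: M_def row_comb_simps row_comb_sq_form row_comb_sym_prod y' zw vscale_simps) simp
    then have "B w M = 0"
      using M S v1 v2 by (intro rcD(7)) (auto simp only: w_def dot_simps intro!: orth_closed)
    moreover have "B w M = s * B v1 M + t * B v2 M"
      unfolding w_def using M S v1 v2 by (simp only: rcD(4,5) orth_closed subsetD)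
    moreover have "row_comb n M v1 = vscale (c * t) y' + vscale t z"
      by (simp only: M_def row_comb_simps row_comb_sq_form row_comb_sym_prod y' z vscale_simps) simp
    then have "B v1 M = b1 (vscale (c * t) y' + vscale t z)"
      by (simp only: b1M[OF M])
    moreover have "row_comb n M v2 = - (vscale (c * s) y' + vscale s z)"
      by (simp only: M_def row_comb_simps row_comb_sq_form row_comb_sym_prod y' z vscale_simps) (simp add: vscale_simps)
    then have "B v2 M = - b2 (vscale (c * s) y' + vscale s z)"
      by (simp only: b2M[OF M] b_neg)
    ultimately show ?thesis
      unfolding y'_def[symmetric] by simp
  qed

  \<comment> \<open>On the plane of \<open>y1\<close> and \<open>y2\<close>, the diagonal parts are
    \<open>g1\<close>, \<open>g2\<close> and the off-diagonal parts are \<open>P\<close>,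
    \<open>Q\<close>.\<close>
  define g1 P Q g2 where "g1 c = b1 (vscale c y1)" and "P c = b1 (vscale c y2)"
    and "Q c = b2 (vscale c y1)" and "g2 c = b2 (vscale c y2)" for c
  have add: "g1 (a + b) = g1 a + g1 b" "P (a + b) = P a + P b"
    "Q (a + b) = Q a + Q b" "g2 (a + b) = g2 a + g2 b" for a b
    by (simp_all only: g1_def P_def Q_def g2_def vscale_simps b_add)
  have neg: "g1 (- a) = - g1 a" "P (- a) = - P a" "Q (- a) = - Q a" "g2 (- a) = - g2 a" for a
    by (simp_all only: g1_def P_def Q_def g2_def vscale_simps b_neg)
  have rel: "s * (g1 (c * t * t) - P (c * t * s)) = t * (Q (c * s * t) - g2 (c * s * s))" for s t c
    using key[of 0 s c t]
    by (simp only: g1_def P_def Q_def g2_def dot_simps vscale_simps b_diff b_add b_zero mult.assoc simp_thms) simp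
  have rel': "s * g1 (c * t * t) + s * P (c * t * s) = t * Q (c * s * t) + t * g2 (c * s * s)" for s t c
    using rel[of "- s" c t] by (simp add: neg algebra_simps)
  \<comment> \<open>For \<open>s = 1\<close>, \<open>rel'\<close> is the functional equation of
    \<open>polarized_linear\<close>; for \<open>t = 1\<close> it is the same equation with the two
    indices exchanged, which serves for \<open>P\<close>.\<close>
  have Q: "Q c = c * Q 1" for c
    by (rule polarized_linear[of g1 P Q g2]) (use add rel'[of 1] in auto)
  have P: "P c = c * P 1" for c
  proof (rule polarized_linear[of g2 Q P g1])
    show "g2 (c * t * t) + Q (c * t) = t * P (c * t) + t * g1 c" for c t
      using rel'[of t c 1] by (simp add: add.commute)
  qed (use add in auto)
  \<comment> \<open>What is left of the diagonal part once its linear part is removed;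
    \<open>f'\<close> shows that both indices give the same function.\<close>
  define f where "f c = g1 c - Q c" for c
  have f': "f c = g2 c - P c" for c
    using rel'[of 1 c 1] by (simp add: f_def algebra_simps)
  have f: "root_linear f"
    unfolding root_linear_def
  proof (intro conjI allI)
    show "f (a + b) = f a + f b" for a b by (simp add: f_def add)
    fix t c
    have "g1 (c * t * t) = t * Q (c * t) + t * g2 c - P (c * t)"
      using rel'[of 1 c t] by (simp add: algebra_simps)
    then show "f (t * t * c) = t * f c"
      unfolding f'[of c] unfolding f_def using Q[of "t * t * c"] Q[of "c * t"] P[of "c * t"] P[of c]
      by (simp add: algebra_simps)
  qed

  \<comment> \<open>With \<open>c = 0\<close> the terms in \<open>y1\<close> and \<open>y2\<close>
    disappear from \<open>key\<close> and only \<open>z\<close> remains.\<close>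
  have b12: "b2 z = b1 z" and b_sc: "b1 (vscale c z) = c * b1 z"
    if "dot n z v1 = 0" "dot n z v2 = 0" for z c
    using key[OF that, of 1 0 1] key[OF that, of 1 0 c] by (simp_all add: vscale_simps)

  \<comment> \<open>The part of \<open>p\<close> that \<open>v1\<close> and \<open>v2\<close> do not
    see; on such vectors \<open>b1\<close> and \<open>b2\<close> agree and are linear.\<close>
  define zp where "zp p = p - vscale (dot n p v1) y1 - vscale (dot n p v2) y2" for p
  have zp: "dot n (zp p) v1 = 0" "dot n (zp p) v2 = 0" for p
    by (simp_all add: zp_def dot_simps yv)
  define l where "l p = dot n p v1 * Q 1 + dot n p v2 * P 1 + b1 (zp p)" for p
  have split: "p = vscale (dot n p v1) y1 + vscale (dot n p v2) y2 + zp p" for p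
    by (simp add: zp_def)
  have e1: "b1 p = g1 (dot n p v1) + P (dot n p v2) + b1 (zp p)" for p
    using arg_cong[OF split[of p], of b1] by (simp only: b_add g1_def P_def)
  have b1l: "b1 p = l p + f (dot n p v1)" for p
    using e1[of p] P[of "dot n p v2"] Q[of "dot n p v1"] by (simp add: l_def f_def)
  have e2: "b2 p = Q (dot n p v1) + g2 (dot n p v2) + b2 (zp p)" for p
    using arg_cong[OF split[of p], of b2] by (simp only: b_add Q_def g2_def)
  have b2l: "b2 p = l p + f (dot n p v2)" for p
    using e2[of p] P[of "dot n p v2"] Q[of "dot n p v1"] b12[OF zp] by (simp add: l_def f')
  define x where "x = (\<lambda>i. l (unit_fun i))"
  have lx: "l p = dot n p x" for p
    unfolding x_def
  proof (rule linear_functional_eq_dot)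
    fix u v c
    have "zp (u + v) = zp u + zp v" "zp (vscale c v) = vscale c (zp v)"
      by (simp_all add: zp_def dot_simps vscale_simps algebra_simps)
    then show "l (u + v) = l u + l v" "l (vscale c v) = c * l v"
      unfolding l_def by (simp_all only: b_add b_sc[OF zp] dot_simps) (simp_all add: algebra_simps)
    show "l v = 0" if v: "\<And>i. i < n \<Longrightarrow> v i = 0"
    proof -
      have "dot n v u = 0" for u using v by (simp add: dot_def)
      then show ?thesis using b1_junk[OF v] by (simp add: l_def zp_def vscale_simps)
    qed
  qed
  have "B v M = bil n M v x + f (bil n M v v)" if v: "v \<in> orth n U" and M: "M \<in> S" for v M
  proof -
    have MS: "M \<in> sym_forms" using M rcD(2) by blast
    define a b where "a = dot n y1 v" and "b = dot n y2 v"
    \<comment> \<open>\<open>r\<close> will be orthogonal to \<open>n\<close> independent vectors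
      and therefore pairs to zero with everything.\<close>
    define w r where "w = vscale a v1 + vscale b v2" and "r = v - w"
    have vwr: "v = w + r" by (simp add: r_def)
    have w: "w \<in> orth n U" using v1 v2 by (auto simp: w_def intro!: orth_closed)
    have r: "r \<in> orth n (y2 # y1 # U)"
      using v w by (auto simp: orth_Cons r_def dot_simps intro!: orth_closed)
        (simp_all add: w_def dot_simps yv a_def b_def)
    then have rU: "r \<in> orth n U" by (simp add: orth_Cons)
    have "indep_list n (y2 # y1 # U)"
      using U(1) v1 v2' yv unfolding indep_list.simps by (metis one_neq_zero)
    from orth_indep_list_full[OF this _ r] have r0: "dot n u r = 0" for u
      using U by simp
    have Mr: "bil n M r u = 0" for u
      using bil_commute[OF MS] r0 by metis
    have "B v M = a * B v1 M + b * B v2 M + B r M"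
      unfolding vwr w_def using M v1 v2 rU by (simp add: rcD(4,5) orth_closed)
    also have "B r M = 0" using rcD(7)[OF rU M Mr] .
    also have "B v1 M = bil n M v1 x + f (bil n M v1 v1)"
      unfolding b1M[OF MS] b1l lx ..
    also have "B v2 M = bil n M v2 x + f (bil n M v2 v2)"
      unfolding b2M[OF MS] b2l lx ..
    finally have "B v M = a * (bil n M v1 x + f (bil n M v1 v1)) + b * (bil n M v2 x + f (bil n M v2 v2))"
      by simp
    moreover have "bil n M v x = a * bil n M v1 x + b * bil n M v2 x"
      unfolding vwr w_def using Mr by (simp only: row_comb_simps dot_simps) simp
    moreover have "f (bil n M v v) = a * f (bil n M v1 v1) + b * f (bil n M v2 v2)"
      unfolding vwr w_def using Mr root_linearD(3)[OF f] by (simp only: root_linear_quad[OF f MS]) simp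
    ultimately show ?thesis by (simp add: algebra_simps)
  qed
  with f show ?thesis unfolding standard_pairing_def by blast
qed


subsection \<open>Induction on the test space\<close>

lemma truncated_vector:
  fixes P :: "(nat \<Rightarrow> 'a::field) \<Rightarrow> bool"
  assumes "P 0" "\<And>u v. P u \<Longrightarrow> P v \<Longrightarrow> P (u + v)" "\<And>c v. P v \<Longrightarrow> P (vscale c v)"
    and "\<And>i. i < k \<Longrightarrow> P (unit_fun i)"
  shows "P (\<lambda>i. if i < k then v i else 0)"
  using assms(4)
proof (induction k)
  case 0
  then show ?case using assms(1) by (simp add: zero_fun_def)
next
  case (Suc k)
  have "(\<lambda>i. if i < Suc k then v i else 0) = (\<lambda>i. if i < k then v i else 0) + vscale (v k) (unit_fun k)"
    by (auto simp: fun_eq_iff vscale_def unit_fun_def less_Suc_eq)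
  then show ?case
    using Suc assms(2,3) by simp
qed

text \<open>\<open>M\<close> is built up through its leading blocks: a product supplies the new row
  and column off the diagonal, a square the new diagonal entry. What lies beyond index
  \<open>n\<close> is in the annihilator.\<close>

lemma sym_forms_subset:
  assumes S: "form_subspace S" "annihilator n [] \<subseteq> S"
    and sq: "\<And>i. i < n \<Longrightarrow> sq_form (unit_fun i) \<in> S"
    and pr: "\<And>i j. i < n \<Longrightarrow> j < n \<Longrightarrow> sym_prod (unit_fun i) (unit_fun j) \<in> S"
  shows "sym_forms \<subseteq> S"
proof
  note DS = form_subspaceD[OF S(1)]
  fix M :: "nat \<Rightarrow> nat \<Rightarrow> 'a" assume M: "M \<in> sym_forms"
  define tr where "tr k i j = (if i < k \<and> j < k then M i j else 0)" for k i j
  have tr: "tr k \<in> S" if "k \<le> n" for k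
    using that
  proof (induction k)
    case 0
    have "tr 0 = 0" by (auto simp: tr_def fun_eq_iff)
    then show ?case using DS(1) by (simp only:)
  next
    case (Suc k)
    have "sym_prod (unit_fun k) (\<lambda>i. if i < k then M i k else 0) \<in> S"
    proof (rule truncated_vector[of "\<lambda>z. sym_prod (unit_fun k) z \<in> S"])
      show "sym_prod (unit_fun k) 0 \<in> S" using DS(1) by (simp add: sym_prod_def zero_fun_def)
      show "sym_prod (unit_fun k) (unit_fun i) \<in> S" if "i < k" for i using pr that Suc.prems by simp
    qed (simp_all only: sym_prod_add sym_prod_vscale DS)
    moreover have "tr (Suc k) = tr k + sym_prod (unit_fun k) (\<lambda>i. if i < k then M i k else 0) + mscale (M k k) (sq_form (unit_fun k))"
      using M by (auto simp: fun_eq_iff tr_def sym_prod_def sq_form_def mscale_def unit_fun_def sym_forms_def less_Suc_eq)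
    ultimately show ?case using Suc sq[of k] by (simp only:) (intro DS; simp)
  qed
  have "tr n \<in> sym_forms" using M by (auto simp: tr_def sym_forms_def)
  then have "M - tr n \<in> sym_forms" using M form_subspaceD(5)[OF form_subspace_sym_forms] by blast
  moreover have "bil n (M - tr n) v x = 0" for v x
    by (simp add: dot_def row_comb_def tr_def)
  ultimately have "M - tr n \<in> S" using S(2) by (auto simp: annihilator_def)
  from DS(2)[OF this tr[of n]] show "M \<in> S" by simp
qed

text \<open>Polarization turns squares into products. Read backwards, a domain that is not full
  misses some square.\<close>

lemma sym_forms_subset_squares:
  assumes S: "form_subspace S" "annihilator n [] \<subseteq> S" and sq: "\<And>y. sq_form y \<in> S"
  shows "sym_forms \<subseteq> S"
proof -
  have "sym_prod y z \<in> S" for y z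
  proof -
    have "sq_form (y + z) - sq_form y - sq_form z \<in> S" by (intro form_subspaceD[OF S(1)] sq)
    then show ?thesis by (simp add: sq_form_add)
  qed
  then show ?thesis using sym_forms_subset[OF S sq] by blast
qed

text \<open>Directions along which the induction hypothesis applies: dividing by \<open>y\<close> also lowers the codimension bound.\<close>

definition good_direction :: "(nat \<Rightarrow> 'a::field) list \<Rightarrow> (nat \<Rightarrow> nat \<Rightarrow> 'a) set \<Rightarrow> (nat \<Rightarrow> 'a) \<Rightarrow> bool" where
  "good_direction U S y \<longleftrightarrow> (\<exists>v\<in>orth n U. dot n y v \<noteq> 0) \<and>
     (\<exists>ws. spans_modulo (form_sum S (annihilator n (y # U))) ws \<and> length ws + length U + 3 \<le> n)"

lemma annihilator_Nil: "annihilator n [] \<subseteq> annihilator n U"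
  by (auto simp: annihilator_def orth_def)

text \<open>By exchange, adjoining the missing square lowers the codimension, and division by
  \<open>y\<close> does adjoin it. If \<open>y\<close> vanished on the test space, its square would
  already lie in \<open>annihilator U\<close>.\<close>

lemma good_directionI:
  assumes rc: "rc_pairing n U S B" and sp: "spans_modulo S ws" "length ws + length U + 2 \<le> n"
    and y: "sq_form y \<notin> S"
  shows "good_direction U S y"
proof -
  note rcD = rc_pairingD[OF rc]
  have *: "\<exists>v\<in>orth n U. dot n y v \<noteq> 0"
  proof (rule ccontr)
    assume "\<not> ?thesis"
    then have "sq_form y \<in> annihilator n U" by (auto simp: annihilator_def row_comb_sq_form dot_simps)
    with y rcD(3) show False by blast
  qed
  obtain ws' where ws': "spans_modulo (extend_by S (sq_form y)) ws'" "length ws = Suc (length ws')"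
    using spans_modulo_exchange[OF rcD(1) sp(1) sq_form_sym_forms y] by blast
  moreover have "extend_by S (sq_form y) \<subseteq> form_sum S (annihilator n (y # U))"
    using form_sum_props[OF rcD(1) form_subspace_annihilator[of n "y # U"]] sq_form_annihilator[of y n U]
    by (intro extend_by_least) blast+
  ultimately have "spans_modulo (form_sum S (annihilator n (y # U))) ws'" "length ws' + length U + 3 \<le> n"
    using sp(2) spans_modulo_mono by auto
  with * show ?thesis unfolding good_direction_def by blast
qed

text \<open>If the domain is not full, let the square of \<open>y0\<close> be missing. Were all
  squares of vectors independent of \<open>y0\<close> modulo \<open>U\<close> present, polarizing
  with two further directions \<open>a\<close>, \<open>b\<close> would produce the square of
  \<open>y0\<close>.\<close>

lemma two_good_directions:
  assumes rc: "rc_pairing n U S B" and sp: "spans_modulo S ws" "length ws + length U + 2 \<le> n"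
    and len: "length U + 3 \<le> n"
  shows "\<exists>y0 y1. good_direction U S y0 \<and> good_direction U S y1 \<and> (\<exists>w\<in>orth n (y0 # U). dot n y1 w \<noteq> 0)"
proof (cases "sym_forms \<subseteq> S")
  case True
  have good: "good_direction U S y" if "\<exists>v\<in>orth n U. dot n y v \<noteq> 0" for y
    using that True len form_sum_props(2)[OF rc_pairingD(1)[OF rc] form_subspace_annihilator[of n "y # U"]]
    unfolding good_direction_def by (auto intro!: exI[of _ "[]"])
  obtain v0 y0 where 0: "v0 \<in> orth n U" "dot n y0 v0 = 1"
    using len by (rule_tac orth_nonzero[of U n]) auto
  obtain v1 y1 where 1: "v1 \<in> orth n (y0 # U)" "dot n y1 v1 = 1"
    using len by (rule_tac orth_nonzero[of "y0 # U" n]) auto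
  have "good_direction U S y0" "good_direction U S y1"
    by (rule good; use 0 1 in \<open>force simp: orth_Cons\<close>)+
  with 1 show ?thesis by (intro exI[of _ y0] exI[of _ y1] conjI bexI[of _ v1]) simp_all
next
  case False
  note rcD = rc_pairingD[OF rc] and DS = form_subspaceD[OF rc_pairingD(1)[OF rc]]
  obtain y0 where y0: "sq_form y0 \<notin> S"
    using False sym_forms_subset_squares[OF rcD(1)] rcD(3) annihilator_Nil by blast
  show ?thesis
  proof (rule ccontr)
    assume contr: "\<not> ?thesis"
    have sq: "sq_form y \<in> S" if "w \<in> orth n (y0 # U)" "dot n y w \<noteq> 0" for y w
      using contr good_directionI[OF rc sp] y0 that by blast
    obtain v a where va: "v \<in> orth n (y0 # U)" "dot n a v = 1"
      using len by (rule_tac orth_nonzero[of "y0 # U" n]) auto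
    obtain v' b' where vb: "v' \<in> orth n (a # y0 # U)" "dot n b' v' = 1"
      using len by (rule_tac orth_nonzero[of "a # y0 # U" n]) auto
    define b where "b = b' - vscale (dot n b' v) a"
    have v': "v' \<in> orth n (y0 # U)" using vb by (auto simp: orth_Cons)
    have d: "dot n a v = 1" "dot n a v' = 0" "dot n b v = 0" "dot n b v' = 1" "dot n y0 v = 0" "dot n y0 v' = 0"
      using va vb by (auto simp: orth_Cons b_def dot_simps)
    have p: "sq_form y0 + sym_prod y0 c \<in> S" if "w \<in> orth n (y0 # U)" "dot n y0 w = 0" "dot n c w \<noteq> 0" for c w
    proof -
      have "sq_form (y0 + c) - sq_form c \<in> S"
        using that by (intro DS(5) sq[of w]) (auto simp: dot_simps)
      then show ?thesis by (simp add: sq_form_add)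
    qed
    \<comment> \<open>The products with \<open>y0\<close> cancel, and one copy of the square of
      \<open>y0\<close> survives.\<close>
    have "(sq_form y0 + sym_prod y0 a) + (sq_form y0 + sym_prod y0 b) - (sq_form y0 + sym_prod y0 (a + b)) \<in> S"
      by (intro DS p[of v a] p[of v' b] p[of v "a + b"] va v') (auto simp: d dot_simps)
    then have "sq_form y0 \<in> S" by (simp add: sym_prod_add)
    with y0 show False by blast
  qed
qed

section \<open>Comparing and gluing solutions along two directions\<close>

text \<open>Both formulas compute \<open>B\<close> on test vectors orthogonal to \<open>y0\<close>
  and \<open>y1\<close>. Forms that are invisible there may be added, which gives the identity on
  the larger domain needed for dimension counts.\<close>

lemma standard_pairings_agree:
  assumes rc: "rc_pairing n U S B"
    and s0: "standard_pairing n (y0 # U) S B x0 f0"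
    and s1: "standard_pairing n (y1 # U) S B x1 f1"
    and v: "v \<in> orth n (y1 # y0 # U)" and M: "M \<in> form_sum S (annihilator n (y0 # U))"
  shows "bil n M v (x0 - x1) + (f0 (bil n M v v) - f1 (bil n M v v)) = 0"
proof -
  from M obtain s N where sN: "M = s + N" "s \<in> S" "N \<in> annihilator n (y0 # U)" by (rule form_sumE)
  have N: "bil n N v x = 0" for x
    using sN(3) v by (auto simp: annihilator_def orth_Cons)
  have "bil n M v x = bil n s v x" for x
    using N[of x] unfolding sN(1) by (simp only: row_comb_simps dot_simps) simp
  moreover have "v \<in> orth n (y0 # U)" "v \<in> orth n (y1 # U)" using v by (auto simp: orth_Cons)
  then have "B v s = bil n s v x0 + f0 (bil n s v v)" "B v s = bil n s v x1 + f1 (bil n s v v)"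
    using s0 s1 sN(2) unfolding standard_pairing_def by blast+
  ultimately show ?thesis by (simp add: dot_simps algebra_simps)
qed

lemma standard_pairing_glue:
  assumes rc: "rc_pairing n U S B"
    and s0: "standard_pairing n (y0 # U) S B x0 f"
    and s1: "standard_pairing n (y1 # U) S B x1 f"
    and g: "good_direction U S y0" and w: "w \<in> orth n (y0 # U)" "dot n y1 w \<noteq> 0"
  shows "standard_pairing n U S B x0 f"
proof -
  obtain ws where ws: "spans_modulo (form_sum S (annihilator n (y0 # U))) ws" "length ws + length U + 3 \<le> n"
    using g by (auto simp: good_direction_def)
  have z: "bil n M v (x0 - x1) = 0"
    if "v \<in> orth n (y1 # y0 # U)" "M \<in> form_sum S (annihilator n (y0 # U))" for v M
    using standard_pairings_agree[OF rc s0 s1 that] by simp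
  \<comment> \<open>The \<open>+ 3\<close> in \<open>good_direction\<close> is just enough for the
    two extra orthogonality conditions.\<close>
  have "length ws + length (y1 # y0 # U) < n" using ws(2) by simp
  from vanish_form[OF ws(1) this z] have "dot n y (x0 - x1) = 0" for y .
  then have x: "dot n y x0 = dot n y x1" for y by (simp add: dot_simps)
  have f: "root_linear f" using s0 by (simp add: standard_pairing_def)
  have "B v M = bil n M v x0 + f (bil n M v v)" if v: "v \<in> orth n U" and M: "M \<in> S" for v M
  proof -
    \<comment> \<open>Removing a multiple of \<open>w\<close> makes the rest orthogonal to
      \<open>y1\<close>, so each summand is covered by one of the two formulas.\<close>
    define w' v' where "w' = vscale (dot n y1 v / dot n y1 w) w" and "v' = v - w'"
    have vv: "v = v' + w'" by (simp add: v'_def)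
    have w': "w' \<in> orth n (y0 # U)" using w by (auto simp: w'_def intro!: orth_closed)
    have v': "v' \<in> orth n (y1 # U)"
      using w w' v by (auto simp: v'_def orth_Cons intro!: orth_closed) (simp add: dot_simps w'_def)
    have "B v M = B v' M + B w' M"
      unfolding vv using w' v' M by (intro rc_pairingD(4)[OF rc]) (auto simp: orth_Cons)
    also have "B v' M = bil n M v' x0 + f (bil n M v' v')"
      using s1 v' M x by (simp add: standard_pairing_def)
    also have "B w' M = bil n M w' x0 + f (bil n M w' w')"
      using s0 w' M by (simp add: standard_pairing_def)
    also have "bil n M v' x0 + f (bil n M v' v') + (bil n M w' x0 + f (bil n M w' w'))
        = bil n M v x0 + f (bil n M v v)"
      unfolding vv root_linear_quad(1)[OF f subsetD[OF rc_pairingD(2)[OF rc] M]] by (simp only: row_comb_simps dot_simps ac_simps)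
    finally show ?thesis .
  qed
  with f show ?thesis by (simp add: standard_pairing_def)
qed

text \<open>Scaling a form whose quadratic value is nonzero forces \<open>f0 - f1\<close> to be
  linear. A nonzero map that is both linear and root-linear allows only scalars with
  \<open>c = c * c\<close>.\<close>

lemma distinct_root_parts_two_elements:
  fixes B :: "(nat \<Rightarrow> 'a::field) \<Rightarrow> (nat \<Rightarrow> nat \<Rightarrow> 'a) \<Rightarrow> 'a"
  assumes rc: "rc_pairing n U S B"
    and s0: "standard_pairing n (y0 # U) S B x0 f0"
    and s1: "standard_pairing n (y1 # U) S B x1 f1"
    and g: "good_direction U S y0" and f: "f0 \<noteq> f1"
  shows "c = 0 \<or> c = (1::'a)"
proof (rule ccontr)
  assume c: "\<not> ?thesis"
  define f where "f a = f0 a - f1 a" for a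
  have sf: "root_linear f"
    unfolding f_def using s0 s1 by (intro root_linear_diff) (auto simp: standard_pairing_def)
  obtain a where a: "f a \<noteq> 0" using f by (auto simp: f_def fun_eq_iff)
  have "\<exists>b. f (c * b) \<noteq> c * f b"
  proof (rule ccontr)
    assume "\<not> ?thesis"
    then have "f (c * b) = c * f b" for b by blast
    then have "c * f a = c * (c * f a)"
      using root_linearD(2)[OF sf, of c a] by (simp add: mult.assoc)
    with c a show False by auto
  qed
  then obtain b where b: "f (c * b) \<noteq> c * f b" ..
  let ?T = "form_sum S (annihilator n (y0 # U))"
  have T: "form_subspace ?T" by (intro form_sum_props rc_pairingD(1)[OF rc] form_subspace_annihilator)
  obtain ws where ws: "spans_modulo ?T ws" "length ws + length U + 3 \<le> n"
    using g by (auto simp: good_direction_def)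
  have "length ws + length (y1 # y0 # U) < n" using ws(2) by simp
  from diagonal_nonzero[OF T ws(1) this] obtain v M
    where v: "v \<in> orth n (y1 # y0 # U)" and M: "M \<in> ?T" "bil n M v v \<noteq> 0" by blast
  \<comment> \<open>Scaling \<open>M\<close> by \<open>d\<close> gives its quadratic form the value
    \<open>b\<close> at \<open>v\<close>.\<close>
  define d where "d = b / bil n M v v"
  have e: "e * bil n M v (x0 - x1) + f (e * bil n M v v) = 0" for e
    using standard_pairings_agree[OF rc s0 s1 v form_subspaceD(3)[OF T M(1), of e]] by (simp add: row_comb_simps dot_simps f_def algebra_simps)
  have "d * bil n M v v = b" "c * d * bil n M v v = c * b" using M by (simp_all add: d_def)
  with e[of d] e[of "c * d"] have "d * bil n M v (x0 - x1) = - f b" "c * d * bil n M v (x0 - x1) = - f (c * b)"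
    by (simp_all add: eq_neg_iff_add_eq_0)
  then have "f (c * b) = c * f b" by (simp add: mult.assoc)
  with b show False by blast
qed

text \<open>Here \<open>f0 - f1\<close> is the identity, and a dimension count shows that
  \<open>y0 + y1\<close> pairs equally with \<open>x0\<close> and \<open>x1\<close>. If its square
  were in \<open>S\<close>, it would kill \<open>w0 + w1\<close>, whereas the two formulas add up to
  \<open>1\<close>.\<close>

lemma two_element_sum_direction:
  fixes B :: "(nat \<Rightarrow> 'a::field) \<Rightarrow> (nat \<Rightarrow> nat \<Rightarrow> 'a) \<Rightarrow> 'a"
  assumes F2: "\<And>c::'a. c = 0 \<or> c = 1"
    and rc: "rc_pairing n U S B"
    and s0: "standard_pairing n (y0 # U) S B x0 f0"
    and s1: "standard_pairing n (y1 # U) S B x1 f1"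
    and g: "good_direction U S y0" and f: "f0 \<noteq> f1"
    and w0: "w0 \<in> orth n (y1 # U)" "dot n y0 w0 = 1" and w1: "w1 \<in> orth n (y0 # U)" "dot n y1 w1 = 1"
  shows "sq_form (y0 + y1) \<notin> S"
proof
  let ?y = "y0 + y1"
  assume M: "sq_form ?y \<in> S"
  have two: "(1::'a) + 1 = 0" using F2[of "1 + 1"] by (metis add_cancel_left_right one_neq_zero)
  have lin: "f = (\<lambda>a. f 1 * a)" if "root_linear f" for f :: "'a \<Rightarrow> 'a"
    using F2 root_linearD(3)[OF that] by (intro ext) (metis mult.right_neutral mult_zero_right)
  have sf: "root_linear f0" "root_linear f1" using s0 s1 by (auto simp: standard_pairing_def)
  have "f0 1 \<noteq> f1 1" using f lin[OF sf(1)] lin[OF sf(2)] by metis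
  then have d1: "f0 1 - f1 1 = 1" using F2[of "f0 1 - f1 1"] by auto
  have diff: "f0 a - f1 a = a" for a
    using F2[of a] d1 root_linearD(3)[OF sf(1)] root_linearD(3)[OF sf(2)] by auto
  let ?T = "form_sum S (annihilator n (y0 # U))"
  obtain ws where ws: "spans_modulo ?T ws" "length ws + length U + 3 \<le> n"
    using g by (auto simp: good_direction_def)
  have T: "?T \<subseteq> sym_forms"
    using rc_pairing_extend[OF rc, of y0] rc_pairingD(2) by blast
  have "length ws + length (y1 # y0 # U) < n" using ws(2) by simp
  from two_element_vanish_form[OF F2 ws(1) this T, of "x0 - x1"] standard_pairings_agree[OF rc s0 s1]
  obtain v where v: "v \<in> orth n (y1 # y0 # U)" "\<And>y. dot n y (x0 - x1) = - dot n y v"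
    unfolding diff by blast
  have "dot n ?y v = 0" using v(1) by (simp add: dot_simps orth_Cons)
  with v(2)[of ?y] have "dot n ?y (x0 - x1) = 0" by (simp only:) simp
  then have x: "dot n ?y x0 = dot n ?y x1" by (simp only: dot_simps(8)) simp
  have y: "dot n ?y w0 = 1" "dot n ?y w1 = 1" using w0 w1 by (auto simp: orth_Cons dot_simps)
  have wU: "w0 \<in> orth n U" "w1 \<in> orth n U" using w0 w1 by (auto simp: orth_Cons)
  have "B (w0 + w1) (sq_form ?y) = 0"
    using wU M y two by (intro rc_pairingD(7)[OF rc] orth_closed) (simp_all only: row_comb_sq_form dot_simps, simp_all)
  moreover have "B (w0 + w1) (sq_form ?y) = B w0 (sq_form ?y) + B w1 (sq_form ?y)"
    using wU M by (intro rc_pairingD(4)[OF rc])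
  moreover have "B w0 (sq_form ?y) = dot n ?y x1 + f1 1"
    using s1 w0 M y by (simp only: standard_pairing_def row_comb_sq_form dot_simps) (simp add: dot_simps)
  moreover have "B w1 (sq_form ?y) = dot n ?y x0 + f0 1"
    using s0 w1 M y by (simp only: standard_pairing_def row_comb_sq_form dot_simps) (simp add: dot_simps)
  ultimately have "(dot n ?y x1 + dot n ?y x1) + (f1 1 + f1 1) + (f0 1 - f1 1) = 0"
    unfolding x by (simp add: algebra_simps)
  moreover have "a + a = 0" for a :: 'a using two by (metis mult_zero_right distrib_left mult.right_neutral)
  ultimately show False using d1 by simp
qed

text \<open>The measure is the dimension of the test space. Each division also shortens the list of
  missing forms, so the bound persists down to dimension two, where it forces the full
  domain.\<close>

lemma rc_pairing_standard:
  fixes B :: "(nat \<Rightarrow> 'a::field) \<Rightarrow> (nat \<Rightarrow> nat \<Rightarrow> 'a) \<Rightarrow> 'a"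
  assumes "rc_pairing n U S B" "spans_modulo S ws" "length ws + length U + 2 \<le> n" "indep_list n U"
  shows "\<exists>x f. standard_pairing n U S B x f"
  using assms
proof (induction "n - length U" arbitrary: U S B ws rule: less_induct)
  case less
  note rc = less.prems(1) and sp = less.prems(2,3)
  show ?case
  proof (cases "length U + 2 = n")
    case True
    with sp have "sym_forms \<subseteq> S" by (cases ws) auto
    from standard_pairing_two_dim[OF rc this less.prems(4) True] show ?thesis .
  next
    case False
    \<comment> \<open>The induction hypothesis solves the extended pairing; its formula is then
      restricted to \<open>S\<close>.\<close>
    have sol: "\<exists>x f. standard_pairing n (y # U) S B x f" if good: "good_direction U S y" for y
    proof -
      from good obtain ws' where ws': "spans_modulo (form_sum S (annihilator n (y # U))) ws'" "length ws' + length U + 3 \<le> n"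
        by (auto simp: good_direction_def)
      obtain B' where B': "rc_pairing n (y # U) (form_sum S (annihilator n (y # U))) B'"
        "\<And>v M. v \<in> orth n (y # U) \<Longrightarrow> M \<in> S \<Longrightarrow> B' v M = B v M"
        using rc_pairing_extend[OF rc, of y] by blast
      have "indep_list n (y # U)" using good less.prems(4) by (auto simp: good_direction_def)
      with less.hyps[OF _ B'(1) ws'(1)] ws'(2)
      obtain x f where "standard_pairing n (y # U) (form_sum S (annihilator n (y # U))) B' x f" by fastforce
      then have "standard_pairing n (y # U) S B x f"
        using B'(2) form_sum_props(2)[OF rc_pairingD(1)[OF rc] form_subspace_annihilator[of n "y # U"]]
        unfolding standard_pairing_def by (metis subsetD)
      then show ?thesis by blast
    qed
    from two_good_directions[OF rc sp] False sp obtain y0 y1 w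
      where g0: "good_direction U S y0" and g1: "good_direction U S y1" and w: "w \<in> orth n (y0 # U)" "dot n y1 w \<noteq> 0" by fastforce
    obtain x0 f0 where s0: "standard_pairing n (y0 # U) S B x0 f0" using sol[OF g0] by blast
    obtain x1 f1 where s1: "standard_pairing n (y1 # U) S B x1 f1" using sol[OF g1] by blast
    show ?thesis
    proof (cases "f0 = f1")
      case True
      with standard_pairing_glue[OF rc s0 _ g0 w] s1 show ?thesis by blast
    next
      case f01: False
      have F2: "c = 0 \<or> c = 1" for c :: 'a
        using distinct_root_parts_two_elements[OF rc s0 s1 g0 f01] .
      have w1: "dot n y1 w = 1" using F2[of "dot n y1 w"] w by blast
      obtain u where u: "u \<in> orth n U" "dot n y0 u = 1" using g0 F2 unfolding good_direction_def by blast
      \<comment> \<open>The correction makes \<open>w0\<close>, \<open>w\<close> dual to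
        \<open>y0\<close>, \<open>y1\<close>.\<close>
      define w0 where "w0 = u - vscale (dot n y1 u) w"
      have w0: "w0 \<in> orth n (y1 # U)" "dot n y0 w0 = 1"
        using u w w1 by (auto simp: w0_def orth_Cons dot_simps intro!: orth_closed)
      have "good_direction U S (y0 + y1)"
        using good_directionI[OF rc sp] two_element_sum_direction[OF F2 rc s0 s1 g0 f01 w0 w(1) w1] by blast
      from sol[OF this] obtain x2 f2 where s2: "standard_pairing n ((y0 + y1) # U) S B x2 f2" by blast
      have sf: "root_linear f0" "root_linear f1" "root_linear f2" using s0 s1 s2 by (auto simp: standard_pairing_def)
      have eq: "g = h" if "root_linear g" "root_linear h" "g 1 = h 1" for g h :: "'a \<Rightarrow> 'a"
        using F2 root_linearD(3)[OF that(1)] root_linearD(3)[OF that(2)] that(3) by (intro ext) metis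
      \<comment> \<open>Each function is determined by its value at \<open>1\<close>;
        \<open>f0\<close> and \<open>f1\<close> differ there and so exhaust the two possible
        values.\<close>
      have "f0 1 = f2 1 \<or> f1 1 = f2 1"
        using eq[OF sf(1,2)] f01 F2 by metis
      then consider "f2 = f0" | "f2 = f1"
        using eq sf by metis
      then show ?thesis
      proof cases
        case 1
        have "dot n (y0 + y1) w \<noteq> 0" using w by (simp add: dot_simps orth_Cons)
        with standard_pairing_glue[OF rc s0 s2[unfolded 1] g0 w(1)] show ?thesis by blast
      next
        case 2
        have "dot n (y0 + y1) w0 \<noteq> 0" using w0 by (simp add: dot_simps orth_Cons)
        with standard_pairing_glue[OF rc s1 s2[unfolded 2] g1 w0(1)] show ?thesis by blast
      qed
    qed
  qed
qed

end

subsection \<open>Transfer to matrices\<close>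

text \<open>A maximal independent subset of \<open>S\<close> is a basis of \<open>S\<close>, and
  replacement against a basis of the whole space completes it.\<close>

lemma (in vectorspace) complement_spanning:
  assumes fd: "fin_dim" and S: "VectorSpace.subspace K S V"
  shows "\<exists>C. finite C \<and> C \<subseteq> carrier V \<and> card C \<le> dim - vectorspace.dim K (V\<lparr>carrier := S\<rparr>)
    \<and> span (S \<union> C) = carrier V"
proof -
  interpret W: vectorspace K "V\<lparr>carrier := S\<rparr>" by (rule subspace_is_vs[OF S])
  have sub: "submodule K S V" using S by (simp add: VectorSpace.subspace_def)
  then have SV: "S \<subseteq> carrier V" by (simp add: submodule_def)
  let ?P = "\<lambda>T. T \<subseteq> S \<and> lin_indpt T"
  have "?P {}" by (auto simp: lin_dep_def)
  then obtain A where A: "finite A" "maximal A ?P"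
    using maximal_exists[of ?P dim "{}"] li_le_dim[OF fd] SV by blast
  have li: "W.lin_dep T \<longleftrightarrow> lin_dep T" if "T \<subseteq> S" for T
    using span_li_not_depend(2)[OF that sub] .
  have max: "maximal A (\<lambda>T. T \<subseteq> carrier (V\<lparr>carrier := S\<rparr>) \<and> W.lin_indpt T)"
    using A(2) li unfolding maximal_def by auto
  have AS: "A \<subseteq> S" "lin_indpt A" using A(2) by (auto simp: maximal_def)
  have dimW: "W.dim = card A"
    using W.dim_basis[OF A(1) W.max_li_is_basis[OF max]] .
  have spA: "span A = S"
    using W.max_li_is_gen[OF max] span_li_not_depend(1)[OF AS(1) sub] by simp
  obtain B where B: "finite B" "basis B" using finite_basis_exists[OF fd] by blast
  then have BV: "B \<subseteq> carrier V" "span B = carrier V" "dim = card B"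
    using dim_basis by (auto simp: basis_def)
  have "A \<subseteq> span B" using AS SV BV by auto
  from replacement[OF A(1) B(1) BV(1) AS(2) this] obtain C where C: "finite C" "C \<subseteq> carrier V"
    "int (card C) \<le> int (card B) - int (card A)" "span (A \<union> C) = span B" by blast
  have "span (A \<union> C) \<subseteq> span (S \<union> C)" using AS by (intro span_is_monotone) auto
  moreover have "span (S \<union> C) \<subseteq> carrier V"
    using SV C span_is_submodule[of "S \<union> C"] by (simp add: submodule_def)
  ultimately show ?thesis
    using C BV dimW by (intro exI[of _ C]) auto
qed

context
  fixes n :: nat
begin

definition to_mat :: "(nat \<Rightarrow> nat \<Rightarrow> 'a::field) \<Rightarrow> 'a mat" where
  "to_mat A = mat n n (\<lambda>(i, j). A i j)"

definition of_mat :: "'a::field mat \<Rightarrow> nat \<Rightarrow> nat \<Rightarrow> 'a" where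
  "of_mat M = (\<lambda>i j. if i < n \<and> j < n then M $$ (i, j) else 0)"

text \<open>Entries beyond index \<open>n\<close> stay free, so that the invisible forms belong to
  it, as \<open>rc_pairing\<close> demands.\<close>

definition forms_of :: "'a::field mat set \<Rightarrow> (nat \<Rightarrow> nat \<Rightarrow> 'a) set" where
  "forms_of T = {A \<in> sym_forms. to_mat A \<in> T}"

lemma to_mat_simps:
  "to_mat (A + B) = to_mat A + to_mat B" "to_mat (mscale c A) = c \<cdot>\<^sub>m to_mat A" "to_mat 0 = 0\<^sub>m n n"
  "to_mat A \<in> carrier_mat n n"
  by (auto simp: to_mat_def mscale_def intro!: eq_matI)

lemma of_mat_simps:
  "M \<in> carrier_mat n n \<Longrightarrow> N \<in> carrier_mat n n \<Longrightarrow> of_mat (M + N) = of_mat M + of_mat N"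
  "M \<in> carrier_mat n n \<Longrightarrow> of_mat (c \<cdot>\<^sub>m M) = mscale c (of_mat M)"
  "of_mat (0\<^sub>m n n) = 0"
  by (auto simp: of_mat_def mscale_def fun_eq_iff)

lemma to_of_mat: "M \<in> carrier_mat n n \<Longrightarrow> to_mat (of_mat M) = M"
  by (auto simp: to_mat_def of_mat_def intro!: eq_matI)

lemma carrier_sym_mat_space_iff: "M \<in> carrier (sym_mat_space n) \<longleftrightarrow> M \<in> carrier_mat n n \<and> of_mat M \<in> sym_forms"
proof (cases "M \<in> carrier_mat n n")
  case True
  have "M\<^sup>T = M \<longleftrightarrow> of_mat M \<in> sym_forms"
  proof
    assume T: "M\<^sup>T = M"
    have "M $$ (i, j) = M $$ (j, i)" if "i < n" "j < n" for i j
      using that True index_transpose_mat(1)[of i M j] by (simp add: T)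
    then show "of_mat M \<in> sym_forms" by (auto simp: of_mat_def sym_forms_def)
  next
    assume S: "of_mat M \<in> sym_forms"
    show "M\<^sup>T = M"
    proof (rule eq_matI)
      fix i j assume "i < dim_row M" "j < dim_col M"
      then show "M\<^sup>T $$ (i, j) = M $$ (i, j)"
        using S True by (auto simp: of_mat_def sym_forms_def) metis
    qed (use True in auto)
  qed
  then show ?thesis using True by (simp add: sym_mat_space_def)
qed (simp add: sym_mat_space_def)

lemma to_mat_carrier: "A \<in> sym_forms \<Longrightarrow> to_mat A \<in> carrier (sym_mat_space n)"
  by (auto simp: sym_mat_space_def to_mat_def sym_forms_def intro!: eq_matI)

lemma annihilator_to_mat: "A \<in> annihilator n [] \<Longrightarrow> to_mat A = 0\<^sub>m n n"
proof (rule eq_matI)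
  fix i j assume A: "A \<in> annihilator n []" and "i < dim_row (0\<^sub>m n n)" "j < dim_col (0\<^sub>m n n)"
  then have ij: "i < n" "j < n" by auto
  have "bil n A (unit_fun i) (unit_fun j) = 0" using A by (auto simp: annihilator_def orth_def)
  then show "to_mat A $$ (i, j) = 0\<^sub>m n n $$ (i, j)"
    using ij by (simp add: row_comb_unit dot_unit_fun to_mat_def)
qed (auto simp: to_mat_def)

lemma submodule_sym_mat_space_iff:
  "submodule class_ring T (sym_mat_space n :: ('a::field, 'a mat) module) \<longleftrightarrow>
    T \<subseteq> carrier (sym_mat_space n) \<and> 0\<^sub>m n n \<in> T \<and> (\<forall>M\<in>T. \<forall>N\<in>T. M + N \<in> T) \<and> (\<forall>c. \<forall>M\<in>T. c \<cdot>\<^sub>m M \<in> T)"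
  using vectorspace_sym_mat_space[of n, where 'a = 'a]
  by (auto simp: submodule_def vectorspace_def sym_mat_space_def module_mat_simps class_ring_simps)

lemma forms_of_subspace:
  fixes T :: "'a::field mat set"
  assumes "submodule class_ring T (sym_mat_space n)"
  shows "form_subspace (forms_of T)" "annihilator n [] \<subseteq> forms_of T"
proof -
  show "form_subspace (forms_of T)"
    using assms form_subspace_sym_forms unfolding submodule_sym_mat_space_iff form_subspace_def forms_of_def
    by (auto simp only: mem_Collect_eq to_mat_simps)
  show "annihilator n [] \<subseteq> forms_of T"
  proof
    fix A :: "nat \<Rightarrow> nat \<Rightarrow> 'a" assume A: "A \<in> annihilator n []"
    then have "to_mat A \<in> T" using assms annihilator_to_mat[OF A] by (simp add: submodule_sym_mat_space_iff)
    with A show "A \<in> forms_of T" by (simp add: forms_of_def annihilator_def)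
  qed
qed

text \<open>Squares and products of unit vectors generate, by \<open>sym_forms_subset\<close>
  applied to their span.\<close>

lemma fin_dim_sym_mat_space: "vectorspace.fin_dim class_ring (sym_mat_space n :: ('a::field, 'a mat) module)"
proof -
  interpret V: vectorspace class_ring "sym_mat_space n :: ('a, 'a mat) module"
    by (rule vectorspace_sym_mat_space)
  let ?G = "(\<lambda>i. to_mat (sq_form (unit_fun i :: nat \<Rightarrow> 'a))) ` {..<n}
    \<union> (\<lambda>(i, j). to_mat (sym_prod (unit_fun i :: nat \<Rightarrow> 'a) (unit_fun j))) ` ({..<n} \<times> {..<n})"
  have G: "?G \<subseteq> carrier (sym_mat_space n)" by (auto intro!: to_mat_carrier)
  have sub: "submodule class_ring (V.span ?G) (sym_mat_space n)" by (rule V.span_is_submodule[OF G])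
  have in_span: "g \<in> V.span ?G" if "g \<in> ?G" for g
    using that V.in_own_span[OF G] by blast
  have "sym_forms \<subseteq> forms_of (V.span ?G)"
    by (rule sym_forms_subset[OF forms_of_subspace[OF sub]]; unfold forms_of_def; intro CollectI conjI in_span; force)
  then have "M \<in> V.span ?G" if "M \<in> carrier (sym_mat_space n)" for M
    using that carrier_sym_mat_space_iff to_of_mat by (fastforce simp: forms_of_def)
  moreover have "V.span ?G \<subseteq> carrier (sym_mat_space n)" using sub by (simp add: submodule_def)
  ultimately show ?thesis
    unfolding V.fin_dim_def using G by (intro exI[of _ ?G]) auto
qed

lemma sym_codim_spans:
  fixes S :: "'a::field mat set"
  assumes S: "VectorSpace.subspace class_ring S (sym_mat_space n)"
  shows "\<exists>ws. spans_modulo (forms_of S) ws \<and> length ws \<le> sym_codim n S"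
proof -
  interpret V: vectorspace class_ring "sym_mat_space n :: ('a, 'a mat) module"
    by (rule vectorspace_sym_mat_space)
  have sub: "submodule class_ring S (sym_mat_space n)" using S by (simp add: VectorSpace.subspace_def)
  obtain C where C: "finite C" "C \<subseteq> carrier (sym_mat_space n)" "card C \<le> sym_codim n S"
    "V.span (S \<union> C) = carrier (sym_mat_space n)"
    using V.complement_spanning[OF fin_dim_sym_mat_space S] unfolding sym_codim_def by blast
  obtain Cs where Cs: "set Cs = C" "length Cs = card C"
    using C(1) finite_distinct_list distinct_card by metis
  have "spans_modulo (forms_of S) (map of_mat Cs)"
  proof (rule spans_moduloI)
    show "form_subspace (forms_of S)" by (rule forms_of_subspace[OF sub])
    fix T :: "(nat \<Rightarrow> nat \<Rightarrow> 'a) set" assume T: "form_subspace T" "forms_of S \<subseteq> T" "set (map of_mat Cs) \<subseteq> T"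
    note DT = form_subspaceD[OF T(1)]
    \<comment> \<open>\<open>T\<close> is pulled back to matrices, where it contains
      \<open>S\<close> and \<open>C\<close> and hence everything.\<close>
    let ?N = "{M \<in> carrier (sym_mat_space n). of_mat M \<in> T}"
    have "submodule class_ring ?N (sym_mat_space n)"
      using DT(1,2,3) form_subspaceD(1,2,3)[OF form_subspace_sym_forms] unfolding submodule_sym_mat_space_iff
      by (auto simp only: carrier_sym_mat_space_iff of_mat_simps mem_Collect_eq zero_carrier_mat add_carrier_mat smult_carrier_mat)
    moreover have "S \<union> C \<subseteq> ?N"
    proof
      fix M assume M: "M \<in> S \<union> C"
      then have MV: "M \<in> carrier (sym_mat_space n)" using C(2) sub by (auto simp: submodule_def)
      have "of_mat M \<in> T"
      proof (cases "M \<in> S")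
        case True
        with MV have "of_mat M \<in> forms_of S" by (simp add: forms_of_def carrier_sym_mat_space_iff to_of_mat)
        with T(2) show ?thesis ..
      qed (use M T(3) Cs in auto)
      with MV show "M \<in> ?N" by simp
    qed
    ultimately have N: "carrier (sym_mat_space n) \<subseteq> ?N"
      using V.span_is_subset[of "S \<union> C" ?N] C(4) by auto
    show "sym_forms \<subseteq> T"
    proof
      fix A :: "nat \<Rightarrow> nat \<Rightarrow> 'a" assume A: "A \<in> sym_forms"
      have 1: "of_mat (to_mat A) \<in> T" using N to_mat_carrier[OF A] by auto
      have "of_mat (to_mat A) \<in> sym_forms" using to_mat_carrier[OF A] carrier_sym_mat_space_iff by blast
      with A have "A - of_mat (to_mat A) \<in> sym_forms" using form_subspaceD(5)[OF form_subspace_sym_forms] by blast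
      moreover have "bil n (A - of_mat (to_mat A)) v x = 0" for v x
        by (simp add: dot_def row_comb_def of_mat_def to_mat_def)
      ultimately have "A - of_mat (to_mat A) \<in> annihilator n []" by (simp add: annihilator_def)
      then have "A - of_mat (to_mat A) \<in> T" using forms_of_subspace(2)[OF sub] T(2) by blast
      from DT(2)[OF this 1] show "A \<in> T" by simp
    qed
  qed
  then show ?thesis using Cs C(3) by (intro exI[of _ "map of_mat Cs"]) simp
qed

lemma mult_mat_vec_index:
  assumes "M \<in> carrier_mat n n" "X \<in> carrier_vec n" "i < n"
  shows "(M *\<^sub>v X) $ i = (\<Sum>j<n. M $$ (i, j) * X $ j)"
  using assms by (auto simp: scalar_prod_def atLeast0LessThan intro!: sum.cong)

lemma range_compatible_hom_carrier:
  "range_compatible_hom n S F \<Longrightarrow> M \<in> S \<Longrightarrow> F M \<in> carrier_vec n"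
  by (auto simp: range_compatible_hom_def hom_def module_vec_simps sym_mat_space_def)

text \<open>Range compatibility writes the value at \<open>A\<close> as \<open>A X\<close>. Moving
  \<open>A\<close> to the side of \<open>v\<close> shows that the pairing is zero when
  \<open>A\<close> kills \<open>v\<close>.\<close>

lemma range_compatible_hom_pairing:
  fixes S :: "'a::field mat set"
  assumes S: "VectorSpace.subspace class_ring S (sym_mat_space n)"
    and F: "range_compatible_hom n S F"
  shows "rc_pairing n [] (forms_of S) (\<lambda>v A. dot n v (\<lambda>i. F (to_mat A) $ i))"
proof -
  have sub: "submodule class_ring S (sym_mat_space n)" using S by (simp add: VectorSpace.subspace_def)
  note F_carrier = range_compatible_hom_carrier[OF F]
  have F_add: "F (M + N) = F M + F N" if "M \<in> S" "N \<in> S" for M N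
    using F that by (auto simp: range_compatible_hom_def hom_def module_vec_simps sym_mat_space_def module_mat_simps)
  have F_im: "\<exists>X\<in>carrier_vec n. F M = M *\<^sub>v X" if "M \<in> S" for M
    using F that by (auto simp: range_compatible_hom_def)
  show ?thesis
    unfolding rc_pairing_def
  proof (intro conjI ballI allI impI)
    show "form_subspace (forms_of S)" "annihilator n [] \<subseteq> forms_of S" by (rule forms_of_subspace[OF sub])+
    show "forms_of S \<subseteq> sym_forms" by (auto simp: forms_of_def)
    fix v :: "nat \<Rightarrow> 'a"
    {
      fix A B assume "A \<in> forms_of S" "B \<in> forms_of S"
      then have "to_mat A \<in> S" "to_mat B \<in> S" by (auto simp: forms_of_def)
      then have "dot n v (\<lambda>i. F (to_mat (A + B)) $ i) = dot n v ((\<lambda>i. F (to_mat A) $ i) + (\<lambda>i. F (to_mat B) $ i))"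
        unfolding to_mat_simps using F_carrier[THEN carrier_vecD] by (intro dot_cong) (auto simp: F_add)
      then show "dot n v (\<lambda>i. F (to_mat (A + B)) $ i)
          = dot n v (\<lambda>i. F (to_mat A) $ i) + dot n v (\<lambda>i. F (to_mat B) $ i)"
        by (simp only: dot_simps)
    next
      fix A assume "A \<in> forms_of S" and z: "\<forall>x. bil n A v x = 0"
      then obtain X where X: "X \<in> carrier_vec n" "F (to_mat A) = to_mat A *\<^sub>v X"
        using F_im[of "to_mat A"] by (auto simp: forms_of_def)
      have "dot n v (\<lambda>i. F (to_mat A) $ i) = dot n v (\<lambda>i. \<Sum>j<n. A i j * X $ j)"
        unfolding X(2) by (rule dot_cong) (auto simp: to_mat_def scalar_prod_def atLeast0LessThan carrier_vecD[OF X(1)])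
      also have "\<dots> = bil n A v (\<lambda>j. X $ j)"
        unfolding dot_def row_comb_def sum_distrib_left sum_distrib_right
        by (subst sum.swap) (simp add: mult_ac)
      finally show "dot n v (\<lambda>i. F (to_mat A) $ i) = 0" using z by simp
    }
  qed (simp_all only: dot_simps)
qed

definition standard_map :: "(nat \<Rightarrow> 'a::field) \<Rightarrow> ('a \<Rightarrow> 'a) \<Rightarrow> 'a mat \<Rightarrow> 'a vec" where
  "standard_map x f M = vec n (\<lambda>i. (\<Sum>j<n. M $$ (i, j) * x j) + f (M $$ (i, i)))"

text \<open>By \<open>vanish_on_orth\<close> it suffices that every vector killed by
  \<open>M\<close> is orthogonal to the image. The linear part is clear, and the diagonal part pairs
  to \<open>f\<close> of the quadratic form by \<open>root_linear_diag\<close>.\<close>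

lemma standard_map_range_compatible:
  assumes f: "root_linear f"
  shows "range_compatible_hom n (carrier (sym_mat_space n)) (standard_map x f)"
proof -
  have "standard_map x f M \<in> (\<lambda>X. M *\<^sub>v X) ` carrier_vec n" if M: "M \<in> carrier (sym_mat_space n)" for M
  proof -
    define A where "A = of_mat M"
    have A: "A \<in> sym_forms" and Mc: "M \<in> carrier_mat n n" using M by (auto simp: carrier_sym_mat_space_iff A_def)
    have Aij: "A i j = M $$ (i, j)" if "i < n" "j < n" for i j using that by (simp add: A_def of_mat_def)
    define b where "b i = dot n (A i) x + f (A i i)" for i
    have "\<forall>v\<in>orth n (map A [0..<n]). dot n b v = 0"
    proof
      fix v assume "v \<in> orth n (map A [0..<n])"
      then have "row_comb n A v j = 0" if "j < n" for j
        using that A by (auto simp: orth_def dot_def row_comb_def sym_forms_def mult.commute)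
      then have z: "bil n A v y = 0" for y by (simp add: dot_def)
      have "dot n (\<lambda>i. dot n (A i) x) v = bil n A v x"
        unfolding dot_def row_comb_def sum_distrib_left sum_distrib_right
        by (subst sum.swap) (simp add: mult_ac)
      moreover have "dot n (\<lambda>i. f (A i i)) v = f (bil n A v v)"
        by (simp add: root_linear_diag[OF f A] dot_commute[of n v])
      moreover have "b = (\<lambda>i. dot n (A i) x) + (\<lambda>i. f (A i i))" by (auto simp: b_def)
      ultimately show "dot n b v = 0" by (simp only: dot_simps z root_linearD(3)[OF f]) simp
    qed
    \<comment> \<open>\<open>c\<close> is the preimage sought: by symmetry a combination of rows is
      one of columns.\<close>
    from vanish_on_orth[OF this] obtain c where c: "\<And>v. dot n b v = (\<Sum>k<n. c k * dot n (A k) v)"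
      by auto
    have "standard_map x f M = M *\<^sub>v vec n c"
    proof (rule eq_vecI)
      fix i assume "i < dim_vec (M *\<^sub>v vec n c)"
      then have i: "i < n" using Mc by simp
      have "standard_map x f M $ i = b i"
        using i by (simp add: standard_map_def b_def dot_def Aij)
      also have "\<dots> = (\<Sum>k<n. c k * A k i)"
        using c[of "unit_fun i"] i by (simp add: dot_unit_fun)
      also have "\<dots> = (\<Sum>k<n. M $$ (i, k) * c k)"
        using A i by (auto simp: Aij[symmetric] sym_forms_def intro!: sum.cong)
      also have "\<dots> = (M *\<^sub>v vec n c) $ i"
        using i by (simp add: mult_mat_vec_index[OF Mc])
      finally show "standard_map x f M $ i = (M *\<^sub>v vec n c) $ i" .
    qed (use Mc in \<open>simp add: standard_map_def\<close>)
    then show ?thesis by auto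
  qed
  moreover have "standard_map x f (M + N) = standard_map x f M + standard_map x f N"
    if "M \<in> carrier_mat n n" "N \<in> carrier_mat n n" for M N
    using that by (intro eq_vecI) (simp_all add: standard_map_def root_linearD(1)[OF f] algebra_simps sum.distrib)
  ultimately show ?thesis
    by (auto simp: range_compatible_hom_def hom_def module_vec_simps sym_mat_space_def module_mat_simps standard_map_def)
qed

end

theorem theorem1p5:
  fixes n :: nat
    and S :: "'a :: field mat set"
    and F :: "'a mat \<Rightarrow> 'a vec"
  assumes "VectorSpace.subspace class_ring S (sym_mat_space n)"
    and "int (sym_codim n S) \<le> int n - 2"
    and "range_compatible_hom n S F"
  shows "standard_hom n S F"
proof -
  obtain ws where ws: "spans_modulo (forms_of n S) ws" "length ws \<le> sym_codim n S"
    using sym_codim_spans[OF assms(1)] by blast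
  \<comment> \<open>The empty \<open>U\<close> means that all vectors are test vectors.\<close>
  then have "length ws + length ([] :: (nat \<Rightarrow> 'a) list) + 2 \<le> n" using assms(2) by simp
  from rc_pairing_standard[OF range_compatible_hom_pairing[OF assms(1,3)] ws(1) this]
  obtain x f where sol: "standard_pairing n [] (forms_of n S) (\<lambda>v A. dot n v (\<lambda>i. F (to_mat n A) $ i)) x f" by auto
  have f: "root_linear f" using sol by (simp add: standard_pairing_def)
  have "standard_map n x f M = F M" if M: "M \<in> S" for M
  proof (rule eq_vecI)
    have MV: "M \<in> carrier (sym_mat_space n)"
      using assms(1) M by (auto simp: VectorSpace.subspace_def submodule_def)
    then have Mc: "M \<in> carrier_mat n n" by (simp add: carrier_sym_mat_space_iff)
    have A: "of_mat n M \<in> forms_of n S"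
      using MV M by (simp add: forms_of_def carrier_sym_mat_space_iff to_of_mat)
    show dim: "dim_vec (standard_map n x f M) = dim_vec (F M)"
      using range_compatible_hom_carrier[OF assms(3) M] by (simp add: standard_map_def)
    fix i assume "i < dim_vec (F M)"
    then have i: "i < n" using dim by (simp add: standard_map_def)
    \<comment> \<open>Unit test vectors read off the coordinates.\<close>
    have "F M $ i = dot n (unit_fun i) (\<lambda>i. F (to_mat n (of_mat n M)) $ i)"
      using i by (simp add: dot_unit_fun to_of_mat[OF Mc])
    also have "\<dots> = bil n (of_mat n M) (unit_fun i) x + f (bil n (of_mat n M) (unit_fun i) (unit_fun i))"
      using sol A by (auto simp: standard_pairing_def orth_def)
    also have "\<dots> = standard_map n x f M $ i"
      using i by (simp add: row_comb_unit dot_unit_fun standard_map_def of_mat_def) (simp add: dot_def)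
    finally show "standard_map n x f M $ i = F M $ i" by simp
  qed
  with standard_map_range_compatible[OF f] assms(3) show ?thesis unfolding standard_hom_def by blast
qed

end
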